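(* Let $p>0$ and let $W\subseteq\mathbb{C}$ be a domain such that $E[T_W^p]<\infty$. Suppose that $f$ is an analytic function on $W$ such that $\limsup_{z\to\partial W}|f(z)|\le K<\infty$, and that there is a constant $C>0$ with $|f(z)|\le Ce^{C|z|^{2p}}+C$ for all $z\in W$. Then $|f(z)|\le K$ for all $z\in W$.
   Context: A domain is a nonempty connected open subset of $\mathbb{C}$. $B_t$ denotes a standard planar Brownian motion, and $E_a$, $P_a$ denote expectation and probability given $B_0=a$ a.s. For a domain $W$, $T_W=\inf\{t\ge 0: B_t\notin W\}$ is the first exit time from $W$. For $p>0$, finiteness of $E_a[T_W^p]$ for one $a\in W$ implies finiteness for all $a\in W$, and in this case one writes $E[T_W^p]<\infty$. $\partial W$ denotes the boundary of $W$ in $\mathbb{C}$ (the point at $\infty$ is not included). The condition $\limsup_{z\to\partial W}|f(z)|\le K$ means that for every $\zeta\in\partial W$, $\limsup_{z\to\zeta,\, z\in W}|f(z)|\le K$. *)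

theory Defs
  imports "HOL-Probability.Probability" "HOL-Complex_Analysis.Complex_Analysis"
begin

text \<open>
  Standard planar Brownian motion \<open>B\<close> on the probability space \<open>M\<close>, started at \<open>a\<close>.
  Real times index the process, but only times \<open>t \<ge> 0\<close> are constrained. An increment over a
  time span \<open>h = t - s\<close> has the rotationally symmetric Gaussian density
  \<open>exp (-|z|\<^sup>2 / (2 h)) / (2 \<pi> h)\<close>, i.e. its real and imaginary part are independent
  with law \<open>N(0, h)\<close>. Path continuity is only required almost surely.
\<close>

locale planar_brownian_motion = prob_space M
  for M :: "'w measure" and B :: "real \<Rightarrow> 'w \<Rightarrow> complex" and a :: complex +
  assumes measurable_at: "\<And>t. 0 \<le> t \<Longrightarrow> B t \<in> borel_measurable M"
    and start: "AE \<omega> in M. B 0 \<omega> = a"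
    and continuous_paths: "AE \<omega> in M. continuous_on {0..} (\<lambda>t. B t \<omega>)"
    and gaussian_increments:
      "\<And>s t. 0 \<le> s \<Longrightarrow> s < t \<Longrightarrow>
        distributed M lborel (\<lambda>\<omega>. B t \<omega> - B s \<omega>)
          (\<lambda>z. ennreal (exp (- (cmod z)\<^sup>2 / (2 * (t - s))) / (2 * pi * (t - s))))"
    and independent_increments:
      "\<And>(\<tau> :: nat \<Rightarrow> real) n. 0 \<le> \<tau> 0 \<Longrightarrow> mono_on {..n} \<tau> \<Longrightarrow>
        indep_vars (\<lambda>_. borel) (\<lambda>i \<omega>. B (\<tau> (Suc i)) \<omega> - B (\<tau> i) \<omega>) {..<n}"

text \<open>The infimum of the empty set is \<open>\<infinity>\<close>: a path that never leaves \<open>W\<close> has exit time \<open>\<infinity>\<close>.\<close>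

definition exit_time :: "complex set \<Rightarrow> (real \<Rightarrow> complex) \<Rightarrow> ennreal" where
  "exit_time W \<gamma> = (INF t \<in> {t. 0 \<le> t \<and> \<gamma> t \<notin> W}. ennreal t)"

text \<open>Real powers on \<open>[0, \<infinity>]\<close>; meant for exponents \<open>p > 0\<close>, where \<open>\<infinity>\<close> is sent to \<open>\<infinity>\<close>.\<close>

definition ennreal_rpow :: "ennreal \<Rightarrow> real \<Rightarrow> ennreal" where
  "ennreal_rpow x p = (if x = \<infinity> then \<infinity> else ennreal (enn2real x powr p))"

text \<open>
  The moment \<open>E\<^sub>a[T\<^sub>W\<^sup>p]\<close> when \<open>B\<close> is a Brownian motion on \<open>M\<close> started at \<open>a\<close>.
  The exit time need only be measurable up to a null set, since paths are continuous only almost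
  surely; the integral of nonnegative functions is a lower integral, so its value is the one
  on the completion of \<open>M\<close>.
\<close>

definition exit_time_moment ::
    "'w measure \<Rightarrow> (real \<Rightarrow> 'w \<Rightarrow> complex) \<Rightarrow> complex set \<Rightarrow> real \<Rightarrow> ennreal" where
  "exit_time_moment M B W p = (\<integral>\<^sup>+ \<omega>. ennreal_rpow (exit_time W (\<lambda>t. B t \<omega>)) p \<partial>M)"

end

theory Submission
  imports Defs
begin

text \<open>
  For \<open>L > K\<close> the function \<open>g = max 0 (ln (|f| / L))\<close>, extended by \<open>0\<close> outside \<open>W\<close>, is continuous
  and subharmonic on the whole plane, vanishes off a closed set \<open>U \<subseteq> W\<close> and is
  \<open>O(1 + |z|\<^sup>2\<^sup>p)\<close>. Subharmonicity on the plane makes \<open>g\<close> of the Brownian path, sampled at dyadic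
  times, a submartingale without any stopping, and since \<open>g\<close> vanishes off \<open>U\<close> this gives
  \<open>g a \<le> E[g (B t); B stays in U up to t]\<close>. A good-\<open>\<lambda>\<close> inequality, comparing the levels \<open>4 ^ i\<close>
  of the path with the times \<open>16 ^ i\<close>, shows that \<open>E[1 + |B t|\<^sup>2\<^sup>p; B stays in U up to t]\<close> tends to
  \<open>0\<close> along \<open>t = 16 ^ i\<close>, because \<open>t powr p * P(T > t)\<close> does. Hence \<open>g a = 0\<close>.

  The starting point plays no special role: if \<open>g\<close> were positive at some point of \<open>W\<close>, logarithmic
  poles glued to \<open>g\<close> would spread positivity from disc to disc up to \<open>a\<close>, and the argument applies to
  the modified function as well.
\<close>

subsection \<open>Planar Gaussian measures\<close>

text \<open>The exponent \<open>2 * p\<close> is the Brownian scale: at time \<open>t\<close> the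
  path typically has size about \<open>sqrt t\<close>, so \<open>cmod (B t) powr (2 * p)\<close> is
  comparable with \<open>t powr p\<close>, which the survival probability beats. This alone does not
  suffice, since conditioning on survival may favour paths that are unusually far out; size and
  survival have to be controlled jointly. The good-lambda inequality does this: whatever the shape
  of \<open>U\<close>, moving from level \<open>r\<close> to level \<open>4 * r\<close> within time
  \<open>t\<close> costs a factor \<open>2 * t / r\<^sup>2\<close>. The factors 4 and 16 match this
  scaling, and a fixed shift \<open>l\<close> of the levels makes \<open>2 / 16 ^ l\<close> small
  enough to beat \<open>16 powr p\<close>. Dyadic sampling reduces everything to finitely many
  independent Gaussian steps, so induction on the number of steps replaces stopping times and the
  strong Markov property. The price is that a step may jump across a level; fourth moments show that
  this error vanishes with the mesh.\<close>

lemma borel_measurable_Complex [measurable (raw)]: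
  assumes "f \<in> borel_measurable M" "g \<in> borel_measurable M"
  shows "(\<lambda>x. Complex (f x) (g x)) \<in> borel_measurable M"
  using assms by (simp add: Complex_eq)

lemma lborel_complex: "(lborel :: complex measure) =
    distr (lborel \<Otimes>\<^sub>M lborel) borel (\<lambda>(x, y). Complex x y)"
proof (rule lborel_eqI)
  fix l u :: complex
  assume "\<And>b. b \<in> Basis \<Longrightarrow> l \<bullet> b \<le> u \<bullet> b"
  from this[of 1] this[of \<i>] have le: "Re l \<le> Re u" "Im l \<le> Im u"
    by (auto simp: inner_complex_def)
  have "(\<lambda>(x, y). Complex x y) -` box l u \<inter> space (lborel \<Otimes>\<^sub>M lborel) =
      {Re l<..<Re u} \<times> {Im l<..<Im u}"
    by (auto simp: in_box_complex_iff space_pair_measure)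
  then have "emeasure (distr (lborel \<Otimes>\<^sub>M lborel) borel (\<lambda>(x, y). Complex x y)) (box l u)
      = ennreal (Re u - Re l) * ennreal (Im u - Im l)"
    using le by (subst emeasure_distr) (auto simp: lborel.emeasure_pair_measure_Times)
  also have "\<dots> = ennreal (\<Prod>b\<in>Basis. (u - l) \<bullet> b)"
    using le by (simp add: Basis_complex_def inner_complex_def ennreal_mult)
  finally show "emeasure (distr (lborel \<Otimes>\<^sub>M lborel) borel (\<lambda>(x, y). Complex x y)) (box l u)
      = ennreal (\<Prod>b\<in>Basis. (u - l) \<bullet> b)" .
qed simp

lemma nn_integral_lborel_complex:
  fixes f :: "complex \<Rightarrow> ennreal"
  assumes [measurable]: "f \<in> borel_measurable borel"
  shows "(\<integral>\<^sup>+z. f z \<partial>lborel) = (\<integral>\<^sup>+x. \<integral>\<^sup>+y. f (Complex x y) \<partial>lborel \<partial>lborel)"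
    and "(\<integral>\<^sup>+z. f z \<partial>lborel) = (\<integral>\<^sup>+y. \<integral>\<^sup>+x. f (Complex x y) \<partial>lborel \<partial>lborel)"
proof -
  have *: "(\<integral>\<^sup>+z. f z \<partial>lborel) = (\<integral>\<^sup>+w. f (case w of (x, y) \<Rightarrow> Complex x y) \<partial>(lborel \<Otimes>\<^sub>M lborel))"
    by (subst lborel_complex, subst nn_integral_distr) auto
  show "(\<integral>\<^sup>+z. f z \<partial>lborel) = (\<integral>\<^sup>+x. \<integral>\<^sup>+y. f (Complex x y) \<partial>lborel \<partial>lborel)"
    unfolding * by (subst lborel.nn_integral_fst[symmetric]) auto
  show "(\<integral>\<^sup>+z. f z \<partial>lborel) = (\<integral>\<^sup>+y. \<integral>\<^sup>+x. f (Complex x y) \<partial>lborel \<partial>lborel)"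
    unfolding * by (subst lborel_pair.nn_integral_snd[symmetric]) auto
qed

lemma nn_integral_lborel_translate:
  fixes f :: "'a :: euclidean_space \<Rightarrow> ennreal"
  assumes [measurable]: "f \<in> borel_measurable borel"
  shows "(\<integral>\<^sup>+x. f (x + c) \<partial>lborel) = (\<integral>\<^sup>+x. f x \<partial>lborel)"
proof -
  have "(\<integral>\<^sup>+x. f x \<partial>lborel) = (\<integral>\<^sup>+x. f x \<partial>distr lborel borel ((+) c))"
    by (simp add: lborel_distr_plus)
  also have "\<dots> = (\<integral>\<^sup>+x. f (x + c) \<partial>lborel)"
    by (subst nn_integral_distr) (auto simp: add.commute)
  finally show ?thesis by simp
qed

text \<open>With one coordinate frozen, a shear only translates the other one, so the inner integral
  does not change.\<close>

lemma nn_integral_lborel_shear: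
  fixes f :: "complex \<Rightarrow> ennreal"
  assumes [measurable]: "f \<in> borel_measurable borel"
  shows "(\<integral>\<^sup>+z. f (Complex (Re z + k * Im z) (Im z)) \<partial>lborel) = (\<integral>\<^sup>+z. f z \<partial>lborel)"
    and "(\<integral>\<^sup>+z. f (Complex (Re z) (Im z + k * Re z)) \<partial>lborel) = (\<integral>\<^sup>+z. f z \<partial>lborel)"
proof -
  show "(\<integral>\<^sup>+z. f (Complex (Re z + k * Im z) (Im z)) \<partial>lborel) = (\<integral>\<^sup>+z. f z \<partial>lborel)"
    by (subst (1 2) nn_integral_lborel_complex(2))
      (auto intro!: nn_integral_cong nn_integral_lborel_translate
        simp: nn_integral_lborel_translate[where f="\<lambda>x. f (Complex x _)"])
  show "(\<integral>\<^sup>+z. f (Complex (Re z) (Im z + k * Re z)) \<partial>lborel) = (\<integral>\<^sup>+z. f z \<partial>lborel)"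
    by (subst (1 2) nn_integral_lborel_complex(1))
      (auto intro!: nn_integral_cong
        simp: nn_integral_lborel_translate[where f="\<lambda>y. f (Complex _ y)"])
qed

text \<open>A rotation by an angle other than \<open>0\<close> and \<open>\<pi>\<close> is a product of three shears.\<close>

lemma nn_integral_lborel_rotate:
  fixes f :: "complex \<Rightarrow> ennreal"
  assumes [measurable]: "f \<in> borel_measurable borel" and c: "cmod c = 1"
  shows "(\<integral>\<^sup>+z. f (c * z) \<partial>lborel) = (\<integral>\<^sup>+z. f z \<partial>lborel)"
proof -
  have gen: "(\<integral>\<^sup>+z. f (c * z) \<partial>lborel) = (\<integral>\<^sup>+z. f z \<partial>lborel)"
    if [measurable]: "f \<in> borel_measurable borel" and c: "cmod c = 1" and im: "Im c \<noteq> 0"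
    for f :: "complex \<Rightarrow> ennreal" and c
  proof -
    define s where "s = Im c"
    \<comment> \<open>For \<open>c = cis \<alpha>\<close> this is
      \<open>- tan (\<alpha> / 2)\<close>, the coefficient of the two outer shears; the middle one
      has coefficient \<open>s = sin \<alpha>\<close>. The entries match because
      \<open>cmod c = 1\<close> gives \<open>k * (2 + k * s) = - s\<close>.\<close>
    define k where "k = (Re c - 1) / s"
    have ks: "k * s = Re c - 1" "s \<noteq> 0" using im by (auto simp: k_def s_def)
    have "(Re c)\<^sup>2 + s\<^sup>2 = 1" using c by (simp add: s_def cmod_power2[symmetric])
    moreover have "(k * (2 + k * s) + s) * s = (k * s + 1)\<^sup>2 + s\<^sup>2 - 1"
      by (simp add: power2_eq_square algebra_simps)
    ultimately have "(k * (2 + k * s) + s) * s = 0" by (simp add: ks(1))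
    then have k2: "k * (2 + k * s) = - s" using ks(2) by simp
    define h1 where "h1 z = Complex (Re z + k * Im z) (Im z)" for z
    define h2 where "h2 z = Complex (Re z) (Im z + s * Re z)" for z
    have [measurable]: "h1 \<in> borel_measurable borel" "h2 \<in> borel_measurable borel"
      by (auto simp: h1_def[abs_def] h2_def[abs_def])
    have "c * z = h1 (h2 (h1 z))" for z
    proof (rule complex_eqI)
      have "Re (h1 (h2 (h1 z))) = (1 + k * s) * Re z + (k * (2 + k * s)) * Im z"
        by (simp add: h1_def h2_def algebra_simps)
      then show "Re (c * z) = Re (h1 (h2 (h1 z)))" unfolding k2 unfolding ks(1) by (simp add: s_def)
      have "Im (h1 (h2 (h1 z))) = s * Re z + (1 + k * s) * Im z"
        by (simp add: h1_def h2_def algebra_simps)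
      then show "Im (c * z) = Im (h1 (h2 (h1 z)))" unfolding ks(1) by (simp add: s_def)
    qed
    then have "(\<integral>\<^sup>+z. f (c * z) \<partial>lborel) = (\<integral>\<^sup>+z. f (h1 (h2 (h1 z))) \<partial>lborel)" by simp
    also have "\<dots> = (\<integral>\<^sup>+z. f (h1 (h2 z)) \<partial>lborel)"
      using nn_integral_lborel_shear(1)[of "\<lambda>z. f (h1 (h2 z))" k] by (simp add: h1_def[symmetric])
    also have "\<dots> = (\<integral>\<^sup>+z. f (h1 z) \<partial>lborel)"
      using nn_integral_lborel_shear(2)[of "\<lambda>z. f (h1 z)" s] by (simp add: h2_def[symmetric])
    also have "\<dots> = (\<integral>\<^sup>+z. f z \<partial>lborel)"
      using nn_integral_lborel_shear(1)[of f k] by (simp add: h1_def[symmetric])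
    finally show ?thesis .
  qed
  show ?thesis
  proof (cases "Im c = 0")
    case False
    then show ?thesis using gen c by simp
  next
    case True
    \<comment> \<open>Here \<open>c\<close> is \<open>1\<close> or \<open>- 1\<close>, and both
      factors of \<open>\<i> * (- \<i> * c)\<close> are off the real axis.\<close>
    then have "(\<integral>\<^sup>+z. f (\<i> * ((- \<i> * c) * z)) \<partial>lborel) = (\<integral>\<^sup>+z. f (\<i> * z) \<partial>lborel)"
      using c by (intro gen[of "\<lambda>z. f (\<i> * z)"]) (auto simp: norm_mult cmod_def)
    also have "\<dots> = (\<integral>\<^sup>+z. f z \<partial>lborel)" by (intro gen) auto
    finally show ?thesis by (simp add: mult.assoc[symmetric])
  qed
qed

definition gauss :: "real \<Rightarrow> complex measure" where
  "gauss h = density lborel (\<lambda>z. ennreal (exp (- (cmod z)\<^sup>2 / (2 * h)) / (2 * pi * h)))"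

lemma sets_gauss [simp, measurable_cong]: "sets (gauss h) = sets borel"
  and space_gauss [simp]: "space (gauss h) = UNIV"
  by (simp_all add: gauss_def)

lemma nn_integral_gauss:
  assumes [measurable]: "f \<in> borel_measurable borel"
  shows "(\<integral>\<^sup>+z. f z \<partial>gauss h)
    = (\<integral>\<^sup>+z. ennreal (exp (- (cmod z)\<^sup>2 / (2 * h)) / (2 * pi * h)) * f z \<partial>lborel)"
  unfolding gauss_def by (subst nn_integral_density) auto

lemma prob_space_gauss:
  assumes h: "h > 0"
  shows "prob_space (gauss h)"
proof (rule prob_spaceI)
  have eq: "exp (- (cmod (Complex x y))\<^sup>2 / (2 * h)) / (2 * pi * h)
      = normal_density 0 (sqrt h) x * normal_density 0 (sqrt h) y" for x y
  proof -
    have "sqrt (2 * pi * h) * sqrt (2 * pi * h) = 2 * pi * h" using h by simp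
    then show ?thesis
      using h by (simp add: normal_density_def cmod_power2 exp_add[symmetric]
          diff_divide_distrib add_divide_distrib del: real_sqrt_mult_self)
  qed
  have "emeasure (gauss h) (space (gauss h)) = (\<integral>\<^sup>+z. 1 \<partial>gauss h)" by simp
  also have "\<dots> = (\<integral>\<^sup>+z. ennreal (exp (- (cmod z)\<^sup>2 / (2 * h)) / (2 * pi * h)) \<partial>lborel)"
    using nn_integral_gauss[of "\<lambda>_. 1" h] by (simp only: mult_1_right borel_measurable_const)
  also have "\<dots> = (\<integral>\<^sup>+x. \<integral>\<^sup>+y. ennreal (normal_density 0 (sqrt h) x * normal_density 0 (sqrt h) y)
      \<partial>lborel \<partial>lborel)"
    unfolding eq[symmetric] by (rule nn_integral_lborel_complex(1)) measurable
  also have "\<dots> = (\<integral>\<^sup>+x. \<integral>\<^sup>+y. ennreal (normal_density 0 (sqrt h) x)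
      * ennreal (normal_density 0 (sqrt h) y) \<partial>lborel \<partial>lborel)"
    by (intro nn_integral_cong ennreal_mult) (auto simp: normal_density_nonneg)
  also have "\<dots> = 1"
  proof -
    have "(\<integral>\<^sup>+y. ennreal (normal_density 0 (sqrt h) y) \<partial>lborel) = 1"
      using prob_space.emeasure_space_1[OF prob_space_normal_density[of "sqrt h" 0]] h
      by (simp add: emeasure_density)
    then show ?thesis by (simp add: nn_integral_cmult nn_integral_multc)
  qed
  finally show "emeasure (gauss h) (space (gauss h)) = 1" .
qed

text \<open>Both the density and Lebesgue measure are invariant under rotation. Through this, circle
  averages become Gaussian averages in \<open>gauss_submean\<close>.\<close>

lemma nn_integral_gauss_rotate:
  assumes [measurable]: "f \<in> borel_measurable borel" and "cmod c = 1"
  shows "(\<integral>\<^sup>+z. f (c * z) \<partial>gauss h) = (\<integral>\<^sup>+z. f z \<partial>gauss h)"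
  using assms(2) nn_integral_lborel_rotate[of
      "\<lambda>z. ennreal (exp (- (cmod z)\<^sup>2 / (2 * h)) / (2 * pi * h)) * f z" c]
  by (simp add: nn_integral_gauss norm_mult)

text \<open>The integrand times the density of variance \<open>h\<close> per coordinate is twice the
  density of variance \<open>2 * h\<close>, which has mass \<open>1\<close>. This exact value is the
  source of the tail and moment bounds that follow.\<close>

lemma nn_integral_gauss_exp_square:
  assumes h: "h > 0"
  shows "(\<integral>\<^sup>+z. ennreal (exp ((cmod z)\<^sup>2 / (4 * h))) \<partial>gauss h) = 2"
proof -
  have *: "exp (- (cmod z)\<^sup>2 / (2 * h)) / (2 * pi * h) * exp ((cmod z)\<^sup>2 / (4 * h))
     = 2 * (exp (- (cmod z)\<^sup>2 / (2 * (2 * h))) / (2 * pi * (2 * h)))" for z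
  proof -
    have "- (cmod z)\<^sup>2 / (2 * h) + (cmod z)\<^sup>2 / (4 * h) = - (cmod z)\<^sup>2 / (2 * (2 * h))"
      using h by (simp add: field_simps)
    then have "exp (- (cmod z)\<^sup>2 / (2 * h)) * exp ((cmod z)\<^sup>2 / (4 * h))
        = exp (- (cmod z)\<^sup>2 / (2 * (2 * h)))"
      by (simp only: exp_add[symmetric])
    then show ?thesis by (simp only: times_divide_eq_left)
  qed
  have "(\<integral>\<^sup>+z. ennreal (exp ((cmod z)\<^sup>2 / (4 * h))) \<partial>gauss h)
      = (\<integral>\<^sup>+z. ennreal (exp (- (cmod z)\<^sup>2 / (2 * h)) / (2 * pi * h))
          * ennreal (exp ((cmod z)\<^sup>2 / (4 * h))) \<partial>lborel)"
    by (rule nn_integral_gauss) simp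
  also have "\<dots> = (\<integral>\<^sup>+z. 2 * ennreal (exp (- (cmod z)\<^sup>2 / (2 * (2 * h))) / (2 * pi * (2 * h))) \<partial>lborel)"
  proof (rule nn_integral_cong)
    fix z
    have "ennreal (exp (- (cmod z)\<^sup>2 / (2 * h)) / (2 * pi * h)) * ennreal (exp ((cmod z)\<^sup>2 / (4 * h)))
      = ennreal (2 * (exp (- (cmod z)\<^sup>2 / (2 * (2 * h))) / (2 * pi * (2 * h))))"
      unfolding *[symmetric] by (rule ennreal_mult''[symmetric]) simp
    also have "\<dots> = 2 * ennreal (exp (- (cmod z)\<^sup>2 / (2 * (2 * h))) / (2 * pi * (2 * h)))"
      by (subst ennreal_mult') simp_all
    finally show "ennreal (exp (- (cmod z)\<^sup>2 / (2 * h)) / (2 * pi * h)) * ennreal (exp ((cmod z)\<^sup>2 / (4 * h)))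
      = 2 * ennreal (exp (- (cmod z)\<^sup>2 / (2 * (2 * h))) / (2 * pi * (2 * h)))" .
  qed
  also have "\<dots> = 2 * (\<integral>\<^sup>+z. ennreal (exp (- (cmod z)\<^sup>2 / (2 * (2 * h))) / (2 * pi * (2 * h))) * 1 \<partial>lborel)"
    by (subst nn_integral_cmult) auto
  also have "\<dots> = 2 * (\<integral>\<^sup>+z. 1 \<partial>gauss (2 * h))"
    by (subst nn_integral_gauss[of "\<lambda>_. 1" "2 * h"]) auto
  also have "\<dots> = 2" using prob_space.emeasure_space_1[OF prob_space_gauss[of "2*h"]] h by simp
  finally show ?thesis .
qed

lemma nn_integral_gauss_exp_norm:
  assumes h: "h > 0"
  shows "(\<integral>\<^sup>+z. ennreal (exp (cmod z)) \<partial>gauss h) < \<infinity>"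
proof -
  have "cmod z \<le> h + (cmod z)\<^sup>2 / (4 * h)" for z
  proof -
    have "0 \<le> (cmod z - 2 * h)\<^sup>2" by simp
    then show ?thesis using h by (simp add: field_simps power2_eq_square)
  qed
  then have "(\<integral>\<^sup>+z. ennreal (exp (cmod z)) \<partial>gauss h)
     \<le> (\<integral>\<^sup>+z. ennreal (exp h) * ennreal (exp ((cmod z)\<^sup>2 / (4 * h))) \<partial>gauss h)"
    by (intro nn_integral_mono) (simp add: ennreal_mult'[symmetric] exp_add[symmetric])
  also have "\<dots> = ennreal (exp h) * 2"
    by (subst nn_integral_cmult) (auto simp: nn_integral_gauss_exp_square h)
  finally show ?thesis by (rule le_less_trans) (simp add: ennreal_mult_less_top)
qed

text \<open>With \<open>x = (cmod z)\<^sup>2 / (4 * h)\<close>, use \<open>x <= exp x\<close> and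
  \<open>x\<^sup>2 <= 2 * exp x\<close>. The exact moments are \<open>2 * h\<close> and
  \<open>8 * h\<^sup>2\<close>; the argument depends only on the order in \<open>h\<close>.\<close>

lemma nn_integral_gauss_moments:
  assumes h: "h > 0"
  shows "(\<integral>\<^sup>+z. ennreal ((cmod z)\<^sup>2) \<partial>gauss h) \<le> ennreal (8 * h)"
    and "(\<integral>\<^sup>+z. ennreal ((cmod z)^4) \<partial>gauss h) \<le> ennreal (64 * h\<^sup>2)"
proof -
  have *: "(\<integral>\<^sup>+z. ennreal (g z) \<partial>gauss h) \<le> ennreal (2 * C)"
    if "\<And>z. g z \<le> C * exp ((cmod z)\<^sup>2 / (4 * h))" "C \<ge> 0" for g C
  proof -
    have "(\<integral>\<^sup>+z. ennreal (g z) \<partial>gauss h)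
        \<le> (\<integral>\<^sup>+z. ennreal C * ennreal (exp ((cmod z)\<^sup>2 / (4 * h))) \<partial>gauss h)"
      using that by (intro nn_integral_mono) (simp add: ennreal_mult'[symmetric] ennreal_leI)
    also have "\<dots> = ennreal C * 2"
      by (subst nn_integral_cmult) (auto simp: nn_integral_gauss_exp_square h)
    also have "\<dots> = ennreal (2 * C)" using that(2) by (simp add: ennreal_mult mult.commute)
    finally show ?thesis .
  qed
  have e1: "x \<le> exp x" if "x \<ge> 0" for x :: real using exp_ge_add_one_self[of x] that by linarith
  have "(cmod z)\<^sup>2 \<le> (4 * h) * exp ((cmod z)\<^sup>2 / (4 * h))" for z
    using e1[of "(cmod z)\<^sup>2 / (4 * h)"] h by (simp add: field_simps)
  from *[OF this] h show "(\<integral>\<^sup>+z. ennreal ((cmod z)\<^sup>2) \<partial>gauss h) \<le> ennreal (8 * h)" by simp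
  have e2: "x\<^sup>2 \<le> 2 * exp x" if "x \<ge> 0" for x :: real
    using exp_lower_Taylor_quadratic[of x] that by simp
  have "(cmod z)^4 \<le> (32 * h\<^sup>2) * exp ((cmod z)\<^sup>2 / (4 * h))" for z
    using e2[of "(cmod z)\<^sup>2 / (4 * h)"] h by (simp add: field_simps power2_eq_square eval_nat_numeral)
  from *[OF this] h show "(\<integral>\<^sup>+z. ennreal ((cmod z)^4) \<partial>gauss h) \<le> ennreal (64 * h\<^sup>2)" by simp
qed

text \<open>Averaging over \<open>z\<close> and \<open>- z\<close> cancels the cross term by the
  parallelogram law, so the mean of the signed inner product never has to be formed.\<close>

lemma nn_integral_gauss_shifted_square:
  assumes h: "h > 0"
  shows "(\<integral>\<^sup>+z. ennreal ((cmod (x + z))\<^sup>2) \<partial>gauss h) \<le> ennreal ((cmod x)\<^sup>2 + 8 * h)"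
proof -
  interpret prob_space "gauss h" by (rule prob_space_gauss) fact
  let ?I = "\<integral>\<^sup>+z. ennreal ((cmod (x + z))\<^sup>2) \<partial>gauss h"
  have sym: "(\<integral>\<^sup>+z. ennreal ((cmod (x + - 1 * z))\<^sup>2) \<partial>gauss h) = ?I"
    by (rule nn_integral_gauss_rotate) auto
  have "2 * ?I = ?I + (\<integral>\<^sup>+z. ennreal ((cmod (x + - 1 * z))\<^sup>2) \<partial>gauss h)"
    unfolding sym by (simp add: mult_2)
  also have "\<dots> = (\<integral>\<^sup>+z. ennreal ((cmod (x + z))\<^sup>2) + ennreal ((cmod (x + - 1 * z))\<^sup>2) \<partial>gauss h)"
    by (subst nn_integral_add) auto
  also have "\<dots> = (\<integral>\<^sup>+z. ennreal (2 * (cmod x)\<^sup>2) + 2 * ennreal ((cmod z)\<^sup>2) \<partial>gauss h)"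
  proof (intro nn_integral_cong)
    fix z
    have "(cmod (x + z))\<^sup>2 + (cmod (x + - 1 * z))\<^sup>2 = 2 * (cmod x)\<^sup>2 + 2 * (cmod z)\<^sup>2"
      by (simp only: cmod_power2) (simp add: power2_eq_square algebra_simps)
    then show "ennreal ((cmod (x + z))\<^sup>2) + ennreal ((cmod (x + - 1 * z))\<^sup>2)
        = ennreal (2 * (cmod x)\<^sup>2) + 2 * ennreal ((cmod z)\<^sup>2)"
      by (simp add: ennreal_plus[symmetric] ennreal_mult' [symmetric]
          del: ennreal_plus flip: ennreal_numeral)
  qed
  also have "\<dots> = ennreal (2 * (cmod x)\<^sup>2) + 2 * (\<integral>\<^sup>+z. ennreal ((cmod z)\<^sup>2) \<partial>gauss h)"
    by (subst nn_integral_add) (auto simp: nn_integral_cmult emeasure_space_1[simplified])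
  also have "\<dots> \<le> ennreal (2 * (cmod x)\<^sup>2) + 2 * ennreal (8 * h)"
    by (intro add_left_mono mult_left_mono nn_integral_gauss_moments h) simp
  also have "\<dots> = 2 * ennreal ((cmod x)\<^sup>2 + 8 * h)"
    using h by (simp add: ennreal_mult' distrib_left)
  finally show ?thesis
    by (subst (asm) ennreal_mult_le_mult_iff) auto
qed

text \<open>Markov's inequality with the fourth moment. The order \<open>h\<^sup>2\<close> is
  essential: about \<open>t / h\<close> steps are taken, so the total overshoot probability is of
  order \<open>h\<close> and vanishes with the mesh, whereas the second moment would leave a bound
  of order \<open>1\<close>.\<close>

lemma emeasure_gauss_norm_gt:
  assumes h: "h > 0" and r: "r > 0"
  shows "emeasure (gauss h) {z. r < cmod z} \<le> ennreal (64 * h\<^sup>2 / r^4)"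
proof -
  have "emeasure (gauss h) {z. r < cmod z} = (\<integral>\<^sup>+z. indicator {z. r < cmod z} z \<partial>gauss h)" by simp
  also have "\<dots> \<le> (\<integral>\<^sup>+z. ennreal (1 / r^4) * ennreal ((cmod z)^4) \<partial>gauss h)"
  proof (intro nn_integral_mono)
    fix z show "indicator {z. r < cmod z} z \<le> ennreal (1 / r^4) * ennreal ((cmod z)^4)"
      using r power_mono[of r "cmod z" 4]
      by (auto simp: indicator_def ennreal_mult'[symmetric] field_simps simp flip: ennreal_1 intro!: ennreal_leI)
  qed
  also have "\<dots> = ennreal (1 / r^4) * (\<integral>\<^sup>+z. ennreal ((cmod z)^4) \<partial>gauss h)"
    by (rule nn_integral_cmult) auto
  also have "\<dots> \<le> ennreal (1 / r^4) * ennreal (64 * h\<^sup>2)"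
    by (intro mult_left_mono nn_integral_gauss_moments h) simp
  also have "\<dots> = ennreal (64 * h\<^sup>2 / r^4)" using r by (simp add: ennreal_mult'[symmetric])
  finally show ?thesis .
qed

subsection \<open>Submean functions\<close>

text \<open>The radius \<open>w\<close> is a complex number, so that a rotation of the circle is just another choice
  of \<open>w\<close>.\<close>

definition submean :: "(complex \<Rightarrow> real) \<Rightarrow> complex \<Rightarrow> complex \<Rightarrow> bool" where
  "submean g z w \<longleftrightarrow> 2 * pi * g z \<le> integral {0..2 * pi} (\<lambda>\<theta>. g (z + w * cis \<theta>))"

text \<open>One radius has to serve all centres near \<open>z\<close>; this lets compactness produce
  a common radius on a closed disc.\<close>

definition locally_submean_on :: "complex set \<Rightarrow> (complex \<Rightarrow> real) \<Rightarrow> bool" where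
  "locally_submean_on S g \<longleftrightarrow>
    (\<forall>z\<in>S. \<exists>r>0. \<forall>z'\<in>ball z r. \<forall>w. cmod w < r \<longrightarrow> submean g z' w)"

lemma circle_integrable:
  fixes g :: "complex \<Rightarrow> 'a :: banach"
  assumes "continuous_on UNIV g"
  shows "(\<lambda>\<theta>. g (z + w * cis \<theta>)) integrable_on {a..b}"
  by (intro integrable_continuous_interval continuous_on_compose2[OF assms]) (auto intro!: continuous_intros)

lemma integral_cis_rotate:
  fixes h :: "complex \<Rightarrow> real"
  assumes h: "continuous_on UNIV h" and c: "cmod c = 1"
  shows "integral {0..2 * pi} (\<lambda>\<theta>. h (cis \<theta> * c)) = integral {0..2 * pi} (\<lambda>\<theta>. h (cis \<theta>))"
proof -
  obtain \<alpha> where \<alpha>: "0 \<le> \<alpha>" "\<alpha> < 2 * pi" "c = cis \<alpha>"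
    using complex_unimodular_polar[OF c] by (auto simp: complex_eq_iff)
  let ?k = "\<lambda>\<theta>. h (cis \<theta>)"
  have int: "?k integrable_on {a..b}" for a b
    using circle_integrable[OF h, of 0 1] by simp
  have per: "integral {2 * pi..2 * pi + \<alpha>} ?k = integral {0..\<alpha>} ?k"
    using integral_shift_Icc_real[of 0 \<alpha> ?k "2 * pi"]
    by (simp add: o_def cis_mult[symmetric] add.commute)
  have "integral {0..2 * pi} (\<lambda>\<theta>. h (cis \<theta> * c)) = integral {\<alpha>..2 * pi + \<alpha>} ?k"
    using integral_shift_Icc_real[of 0 "2 * pi" ?k \<alpha>]
    by (simp add: o_def cis_mult[symmetric] \<alpha>(3) mult.commute)
  also have "\<dots> = integral {\<alpha>..2 * pi} ?k + integral {2 * pi..2 * pi + \<alpha>} ?k"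
    using \<alpha> by (intro Henstock_Kurzweil_Integration.integral_combine[symmetric] int) auto
  also have "\<dots> = integral {0..\<alpha>} ?k + integral {\<alpha>..2 * pi} ?k" unfolding per by simp
  also have "\<dots> = integral {0..2 * pi} ?k"
    using \<alpha> by (intro Henstock_Kurzweil_Integration.integral_combine int) auto
  finally show ?thesis .
qed

text \<open>The surplus \<open>(cmod w)\<^sup>2\<close> over the centre value is the strict gain
  that drives the maximum principle; the first harmonics integrate to \<open>0\<close> over a full
  period.\<close>

lemma integral_circle_square:
  "integral {0..2 * pi} (\<lambda>\<theta>. (cmod (y + w * cis \<theta>))\<^sup>2) = 2 * pi * ((cmod y)\<^sup>2 + (cmod w)\<^sup>2)"
proof -
  define p q where "p = 2 * (Re y * Re w + Im y * Im w)" and "q = 2 * (Im y * Re w - Re y * Im w)"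
  have eq: "(cmod (y + w * cis \<theta>))\<^sup>2 = ((cmod y)\<^sup>2 + (cmod w)\<^sup>2) + p * cos \<theta> + q * sin \<theta>" for \<theta>
  proof -
    have "(cmod (y + u))\<^sup>2 = (cmod y)\<^sup>2 + (cmod u)\<^sup>2 + 2 * (Re y * Re u + Im y * Im u)" for u
      unfolding cmod_power2 by (simp add: power2_eq_square algebra_simps)
    from this[of "w * cis \<theta>"] show ?thesis
      by (simp add: norm_mult p_def q_def algebra_simps)
  qed
  have "((\<lambda>\<theta>. ((cmod y)\<^sup>2 + (cmod w)\<^sup>2) + p * cos \<theta> + q * sin \<theta>) has_integral
     (((cmod y)\<^sup>2 + (cmod w)\<^sup>2) * (2 * pi) + p * sin (2 * pi) - q * cos (2 * pi))
      - (((cmod y)\<^sup>2 + (cmod w)\<^sup>2) * 0 + p * sin 0 - q * cos 0)) {0..2 * pi}"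
    by (rule fundamental_theorem_of_calculus)
      (auto intro!: derivative_eq_intros simp: has_real_derivative_iff_has_vector_derivative[symmetric])
  then show ?thesis unfolding eq by (simp add: integral_unique mult.commute)
qed

text \<open>Adding \<open>\<eta> * (cmod z)\<^sup>2\<close> makes the submean inequality strict,
  which excludes a maximum at an interior point of the disc.\<close>

lemma max_principle_disc:
  fixes m :: "complex \<Rightarrow> real"
  assumes m: "continuous_on UNIV m" and r: "r > 0" and R: "R > 0" and \<eta>: "\<eta> > 0"
    and sub: "\<And>z w. cmod z \<le> R \<Longrightarrow> cmod w < r \<Longrightarrow> submean m z w"
  shows "\<exists>y. cmod y = R \<and> m 0 \<le> m y + \<eta> * R\<^sup>2"
proof -
  let ?F = "\<lambda>z. m z + \<eta> * (cmod z)\<^sup>2"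
  have "continuous_on (cball 0 R) ?F"
    by (intro continuous_intros continuous_on_subset[OF m]) auto
  then obtain y where y: "y \<in> cball 0 R" and max: "\<And>z. z \<in> cball 0 R \<Longrightarrow> ?F z \<le> ?F y"
    using continuous_attains_sup[of "cball 0 R" ?F] R by auto
  have "cmod y = R"
  proof (rule ccontr)
    assume "cmod y \<noteq> R"
    with y have yR: "cmod y < R" by simp
    define s where "s = min r (R - cmod y) / 2"
    have s_le: "s > 0" "s \<le> r / 2" "2 * s \<le> R - cmod y" using r yR by (auto simp: s_def)
    have s: "s > 0" "s < r" "cmod y + s \<le> R" using s_le r by linarith+
    have "2 * pi * m y \<le> integral {0..2 * pi} (\<lambda>\<theta>. m (y + of_real s * cis \<theta>))"
      using sub[of y "of_real s"] yR s by (simp add: submean_def)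
    also have "\<dots> \<le> integral {0..2 * pi} (\<lambda>\<theta>. ?F y - \<eta> * (cmod (y + of_real s * cis \<theta>))\<^sup>2)"
    proof (rule integral_le)
      show "(\<lambda>\<theta>. m (y + of_real s * cis \<theta>)) integrable_on {0..2 * pi}"
        by (rule circle_integrable[OF m])
      show "(\<lambda>\<theta>. ?F y - \<eta> * (cmod (y + of_real s * cis \<theta>))\<^sup>2) integrable_on {0..2 * pi}"
        by (intro integrable_continuous_interval continuous_intros)
      fix \<theta> 
      have "cmod (y + of_real s * cis \<theta>) \<le> cmod y + s"
        using s by (intro norm_triangle_le) (simp add: norm_mult)
      then have "y + of_real s * cis \<theta> \<in> cball 0 R" using s by simp
      from max[OF this]
      show "m (y + of_real s * cis \<theta>) \<le> ?F y - \<eta> * (cmod (y + of_real s * cis \<theta>))\<^sup>2" by simp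
    qed
    also have "\<dots> = 2 * pi * ?F y - \<eta> * (2 * pi * ((cmod y)\<^sup>2 + s\<^sup>2))"
      using s integral_circle_square[of y "of_real s"]
      by (subst integral_diff) (auto intro!: integrable_continuous_interval continuous_intros)
    also have "\<dots> = 2 * pi * m y - 2 * pi * \<eta> * s\<^sup>2" by (simp add: algebra_simps)
    finally have "2 * pi * \<eta> * s\<^sup>2 \<le> 0" by linarith
    moreover have "2 * pi * \<eta> * s\<^sup>2 > 0" using s \<eta> pi_gt_zero by simp
    ultimately show False by linarith
  qed
  moreover have "m 0 \<le> m y + \<eta> * R\<^sup>2" using max[of 0] R \<open>cmod y = R\<close> by simp
  ultimately show ?thesis by blast
qed

lemma locally_submean_uniform:
  assumes "locally_submean_on K g" "compact K"
  shows "\<exists>r>0. \<forall>z\<in>K. \<forall>w. cmod w < r \<longrightarrow> submean g z w"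
proof -
  obtain f where f: "\<And>z. z \<in> K \<Longrightarrow> f z > 0"
      "\<And>z z' w. z \<in> K \<Longrightarrow> z' \<in> ball z (f z) \<Longrightarrow> cmod w < f z \<Longrightarrow> submean g z' w"
    using assms(1) unfolding locally_submean_on_def by metis
  obtain D where D: "D \<subseteq> K" "finite D" "K \<subseteq> (\<Union>z\<in>D. ball z (f z))"
  proof (rule compactE_image[OF assms(2), of K "\<lambda>z. ball z (f z)"])
    show "K \<subseteq> (\<Union>z\<in>K. ball z (f z))" using f(1) by force
  qed auto
  \<comment> \<open>The inserted \<open>1\<close> gives \<open>Min\<close> a meaning when
    \<open>K\<close> is empty.\<close>
  define r where "r = Min (insert 1 (f ` D))"
  have r: "r > 0" "\<And>z. z \<in> D \<Longrightarrow> r \<le> f z" using D f(1) by (auto simp: r_def)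
  have "submean g z w" if z: "z \<in> K" and w: "cmod w < r" for z w
  proof -
    obtain d where "d \<in> D" "z \<in> ball d (f d)" using subsetD[OF D(3) z] by blast
    then show ?thesis using f(2)[of d z w] r(2)[of d] D w by auto
  qed
  then show ?thesis using r(1) by blast
qed

text \<open>Averaging over all rotations about the centre reduces the passage from small circles to
  arbitrary ones to the maximum principle, since a radial function is constant on the boundary
  of the disc.\<close>

lemma locally_submean_imp_submean:
  fixes g :: "complex \<Rightarrow> real"
  assumes g: "continuous_on UNIV g" and loc: "locally_submean_on UNIV g"
  shows "submean g x w"
proof (cases "w = 0")
  case True
  then show ?thesis by (simp add: submean_def)
next
  case False
  define R where "R = cmod w"
  have R: "R > 0" using False by (simp add: R_def)
  define m where "m y = integral {0..2 * pi} (\<lambda>\<phi>. g (x + cis \<phi> * y))" for y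
  have cm: "continuous_on UNIV m"
  proof -
    have "continuous_on (UNIV \<times> cbox 0 (2 * pi)) (\<lambda>(y, \<phi>). g (x + cis \<phi> * y))"
      unfolding split_def by (intro continuous_on_compose2[OF g] continuous_intros) auto
    from integral_continuous_on_param[OF this] show ?thesis
      by (simp add: m_def[abs_def] cbox_interval)
  qed
  have "locally_submean_on (cball x R) g" using loc by (auto simp: locally_submean_on_def)
  then obtain r where r: "r > 0" "\<And>z w. z \<in> cball x R \<Longrightarrow> cmod w < r \<Longrightarrow> submean g z w"
    using locally_submean_uniform[of "cball x R" g] by auto
  have sub: "submean m y \<rho>" if y: "cmod y \<le> R" and \<rho>: "cmod \<rho> < r" for y \<rho>
  proof -
    let ?k = "\<lambda>\<phi> \<theta>. g (x + cis \<phi> * (y + \<rho> * cis \<theta>))"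
    have k: "continuous_on UNIV (\<lambda>p. ?k (fst p) (snd p))"
      by (intro continuous_on_compose2[OF g] continuous_intros) auto
    have "2 * pi * m y = integral {0..2 * pi} (\<lambda>\<phi>. 2 * pi * g (x + cis \<phi> * y))"
      by (simp add: m_def)
    also have "\<dots> \<le> integral {0..2 * pi} (\<lambda>\<phi>. integral {0..2 * pi} (\<lambda>\<theta>. ?k \<phi> \<theta>))"
    proof (rule integral_le)
      show "(\<lambda>\<phi>. 2 * pi * g (x + cis \<phi> * y)) integrable_on {0..2 * pi}"
        by (intro integrable_continuous_interval continuous_intros continuous_on_compose2[OF g]) auto
      have "continuous_on (UNIV \<times> cbox 0 (2 * pi)) (\<lambda>(\<phi>, \<theta>). ?k \<phi> \<theta>)"
        unfolding split_def by (rule continuous_on_subset[OF k]) simp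
      from integral_continuous_on_param[OF this]
      show "(\<lambda>\<phi>. integral {0..2 * pi} (\<lambda>\<theta>. ?k \<phi> \<theta>)) integrable_on {0..2 * pi}"
        unfolding cbox_interval
        by (intro integrable_continuous_interval) (rule continuous_on_subset, auto)
      fix \<phi>
      \<comment> \<open>Multiplication by \<open>cis \<phi>\<close> turns a circle about
        \<open>y\<close> into one about the rotated centre with complex radius
        \<open>cis \<phi> * \<rho>\<close>, so the bound for \<open>g\<close> applies for each
        \<open>\<phi>\<close> separately.\<close>
      have "submean g (x + cis \<phi> * y) (cis \<phi> * \<rho>)"
        using y \<rho> by (intro r(2)) (auto simp: dist_norm norm_mult)
      then show "2 * pi * g (x + cis \<phi> * y) \<le> integral {0..2 * pi} (\<lambda>\<theta>. ?k \<phi> \<theta>)"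
        by (simp add: submean_def algebra_simps)
    qed
    also have "\<dots> = integral {0..2 * pi} (\<lambda>\<theta>. integral {0..2 * pi} (\<lambda>\<phi>. ?k \<phi> \<theta>))"
    proof -
      have "continuous_on (cbox (0, 0) (2 * pi, 2 * pi)) (\<lambda>(\<phi>, \<theta>). ?k \<phi> \<theta>)"
        unfolding split_def by (rule continuous_on_subset[OF k]) simp
      from integral_swap_continuous[OF this] show ?thesis by (simp add: cbox_interval)
    qed
    also have "\<dots> = integral {0..2 * pi} (\<lambda>\<theta>. m (y + \<rho> * cis \<theta>))" by (simp add: m_def)
    finally show ?thesis by (simp add: submean_def)
  qed
  have "m 0 \<le> m w"
  proof (rule field_le_epsilon)
    fix e :: real assume "e > 0"
    then obtain y where y: "cmod y = R" "m 0 \<le> m y + e / R\<^sup>2 * R\<^sup>2"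
      using max_principle_disc[OF cm r(1) R, of "e / R\<^sup>2"] sub R by auto
    have "m y = integral {0..2 * pi} (\<lambda>\<phi>. g (x + (cis \<phi> * (y / w)) * w))"
      using False by (simp add: m_def mult.assoc)
    also have "\<dots> = m w"
      unfolding m_def using y False R
      by (intro integral_cis_rotate[of "\<lambda>c. g (x + c * w)"])
        (auto intro!: continuous_on_compose2[OF g] continuous_intros simp: norm_divide R_def)
    finally show "m 0 \<le> m w + e" using y R by simp
  qed
  then show ?thesis by (simp add: m_def submean_def mult.commute)
qed

text \<open>A rotation-invariant law is a mixture of uniform laws on circles, so it suffices to
  integrate the circle inequality over \<open>z\<close> as complex radius. Circles of every size
  occur, whence the passage from local to global submean values above.\<close>

lemma gauss_submean:
  fixes g :: "complex \<Rightarrow> real"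
  assumes g: "continuous_on UNIV g" and nonneg: "\<And>z. g z \<ge> 0"
    and loc: "locally_submean_on UNIV g" and h: "h > 0"
  shows "ennreal (g x) \<le> (\<integral>\<^sup>+z. ennreal (g (x + z)) \<partial>gauss h)"
proof -
  interpret prob_space "gauss h" by (rule prob_space_gauss) fact
  interpret pair_sigma_finite lborel "gauss h" ..
  have [measurable]: "g \<in> borel_measurable borel"
    using g by (rule borel_measurable_continuous_onI)
  have [measurable]: "cis \<in> borel_measurable borel"
    by (intro borel_measurable_continuous_onI continuous_intros)
  let ?I = "\<integral>\<^sup>+z. ennreal (g (x + z)) \<partial>gauss h"
  have "ennreal (2 * pi) * ennreal (g x) = (\<integral>\<^sup>+z. ennreal (2 * pi * g x) \<partial>gauss h)"
    by (simp add: ennreal_mult nonneg emeasure_space_1[simplified])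
  also have "\<dots> \<le> (\<integral>\<^sup>+z. \<integral>\<^sup>+\<theta>. ennreal (g (x + cis \<theta> * z)) * indicator {0..2 * pi} \<theta> \<partial>lborel \<partial>gauss h)"
  proof (rule nn_integral_mono)
    fix z
    have "ennreal (2 * pi * g x) \<le> ennreal (integral {0..2 * pi} (\<lambda>\<theta>. g (x + z * cis \<theta>)))"
      using locally_submean_imp_submean[OF g loc, of x z] by (auto simp: submean_def intro: ennreal_leI)
    also have "\<dots> = (\<integral>\<^sup>+\<theta>. ennreal (g (x + z * cis \<theta>)) * indicator {0..2 * pi} \<theta> \<partial>lborel)"
      by (rule nn_integral_has_integral_lebesgue'[symmetric])
        (auto simp: nonneg intro!: integrable_integral circle_integrable[OF g])
    finally show "ennreal (2 * pi * g x)
      \<le> (\<integral>\<^sup>+\<theta>. ennreal (g (x + cis \<theta> * z)) * indicator {0..2 * pi} \<theta> \<partial>lborel)"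
      by (simp add: mult.commute)
  qed
  also have "\<dots> = (\<integral>\<^sup>+\<theta>. \<integral>\<^sup>+z. ennreal (g (x + cis \<theta> * z)) * indicator {0..2 * pi} \<theta> \<partial>gauss h \<partial>lborel)"
    by (rule Fubini') measurable
  also have "\<dots> = (\<integral>\<^sup>+\<theta>. ?I * indicator {0..2 * pi} \<theta> \<partial>lborel)"
    by (intro nn_integral_cong, subst nn_integral_multc, measurable)
      (subst nn_integral_gauss_rotate[of "\<lambda>z. ennreal (g (x + z))"], auto)
  also have "\<dots> = ?I * emeasure lborel {0..2 * pi}"
    by (rule nn_integral_cmult_indicator) simp
  also have "\<dots> = ennreal (2 * pi) * ?I" by (simp add: mult.commute[of ?I])
  finally show ?thesis by (subst (asm) ennreal_mult_le_mult_iff) auto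
qed

text \<open>On the ball \<open>ln (cmod (F u))\<close> is the real part of a holomorphic logarithm
  of \<open>F\<close>; Cauchy's formula at the centre gives the mean value property, even with
  equality.\<close>

lemma submean_ln_norm:
  assumes F: "F holomorphic_on ball z r" and nz: "\<And>u. u \<in> ball z r \<Longrightarrow> F u \<noteq> 0" and w: "cmod w < r"
  shows "submean (\<lambda>u. ln (cmod (F u))) z w"
proof -
  have r: "r > 0" using w norm_ge_zero[of w] by linarith
  obtain G where G: "G holomorphic_on ball z r" "\<And>u. u \<in> ball z r \<Longrightarrow> exp (G u) = F u"
    using holomorphic_logarithm_exists[of "ball z r" F z] F nz r by auto
  have ln: "ln (cmod (F u)) = Re (G u)" if "u \<in> ball z r" for u
    by (simp add: G(2)[OF that, symmetric])
  \<comment> \<open>Rescaling by the complex radius moves the circle to the unit circle, and also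
    covers \<open>w = 0\<close>.\<close>
  define H where "H u = G (z + w * u)" for u
  have sub: "(\<lambda>u. z + w * u) ` cball 0 1 \<subseteq> ball z r"
  proof clarify
    fix u :: complex assume "u \<in> cball 0 1"
    then have "cmod (w * u) \<le> cmod w" by (simp add: norm_mult mult_left_le)
    then show "z + w * u \<in> ball z r" using w by (simp add: dist_norm)
  qed
  have H: "H holomorphic_on cball 0 1"
    unfolding H_def[abs_def]
    by (rule holomorphic_on_compose_gen[OF _ G(1) sub, unfolded o_def]) (intro holomorphic_intros)
  have "((\<lambda>u. H u / (u - 0)) has_contour_integral 2 * of_real pi * \<i> * H 0) (circlepath 0 1)"
    by (rule Cauchy_integral_circlepath)
      (use H in \<open>auto intro: holomorphic_on_imp_continuous_on elim: holomorphic_on_subset\<close>)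
  then have "((\<lambda>t. H (cis t) / cis t * \<i> * cis t) has_integral 2 * of_real pi * \<i> * H 0) {0..2 * pi}"
    unfolding circlepath_def by (subst (asm) has_contour_integral_part_circlepath_iff) auto
  then have "((\<lambda>t. \<i> * H (cis t)) has_integral 2 * of_real pi * \<i> * H 0) {0..2 * pi}"
    by (simp add: field_simps)
  from has_integral_Im[OF this]
  have "((\<lambda>t. Re (H (cis t))) has_integral 2 * pi * Re (H 0)) {0..2 * pi}" by simp
  moreover have "ln (cmod (F (z + w * cis t))) = Re (H (cis t))" for t
  proof -
    have "z + w * cis t \<in> ball z r" by (rule sub[THEN subsetD], rule image_eqI[OF refl]) simp
    then show ?thesis by (simp add: ln H_def)
  qed
  moreover have "ln (cmod (F z)) = Re (H 0)" using ln[of z] r by (simp add: H_def)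
  ultimately show ?thesis by (simp add: submean_def integral_unique)
qed

section \<open>Constructing submean functions\<close>

lemma circle_integrable_on:
  fixes g :: "complex \<Rightarrow> 'a :: banach"
  assumes "continuous_on S g" and "\<And>\<theta>. z + w * cis \<theta> \<in> S"
  shows "(\<lambda>\<theta>. g (z + w * cis \<theta>)) integrable_on {a..b}"
  by (intro integrable_continuous_interval continuous_on_compose2[OF assms(1)])
    (use assms(2) in \<open>auto intro!: continuous_intros\<close>)

text \<open>Touching from below is how maxima are handled: the centre value is shared, while the
  circle integral can only grow.\<close>

lemma submean_lower:
  assumes "continuous_on S g" "continuous_on S k" "\<And>\<theta>. z + w * cis \<theta> \<in> S"
    and "\<And>u. u \<in> S \<Longrightarrow> k u \<le> g u" "g z = k z" "submean k z w"
  shows "submean g z w"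
proof -
  have "integral {0..2 * pi} (\<lambda>\<theta>. k (z + w * cis \<theta>)) \<le> integral {0..2 * pi} (\<lambda>\<theta>. g (z + w * cis \<theta>))"
    using assms by (intro integral_le circle_integrable_on[where S=S]) auto
  with assms(5,6) show ?thesis by (simp add: submean_def)
qed

lemma locally_submean_on_Un:
  "locally_submean_on S g \<Longrightarrow> locally_submean_on T g \<Longrightarrow> locally_submean_on (S \<union> T) g"
  by (auto simp: locally_submean_on_def)

text \<open>Here \<open>P z r\<close> stands for any information that persists when the radius
  shrinks; the doubled ball keeps circles about nearby centres inside \<open>S\<close>.\<close>

lemma locally_submean_onI:
  assumes "open S"
    and "\<And>z r z' w. z \<in> S \<Longrightarrow> r > 0 \<Longrightarrow> ball z (2 * r) \<subseteq> S \<Longrightarrow> z' \<in> ball z r \<Longrightarrow> cmod w < r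
      \<Longrightarrow> ball z' r \<subseteq> S \<Longrightarrow> (\<And>\<theta>. z' + w * cis \<theta> \<in> S) \<Longrightarrow> P z r \<Longrightarrow> submean g z' w"
    and "\<And>z. z \<in> S \<Longrightarrow> \<exists>r>0. P z r"
    and mono: "\<And>z r s. P z r \<Longrightarrow> 0 < s \<Longrightarrow> s \<le> r \<Longrightarrow> P z s"
  shows "locally_submean_on S g"
  unfolding locally_submean_on_def
proof
  fix z assume z: "z \<in> S"
  obtain d where d: "d > 0" "ball z d \<subseteq> S" using \<open>open S\<close> z by (auto simp: open_contains_ball)
  obtain e where e: "e > 0" "P z e" using assms(3)[OF z] by blast
  define r where "r = min e (d / 2)"
  have r: "r > 0" "ball z (2 * r) \<subseteq> S" "P z r"
    using d e by (auto simp: r_def intro: mono[OF e(2)])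
  have "submean g z' w" if "z' \<in> ball z r" "cmod w < r" for z' w
  proof (rule assms(2)[OF z r(1,2) that])
    have *: "ball z' r \<subseteq> ball z (2 * r)"
    proof
      fix u assume "u \<in> ball z' r"
      then show "u \<in> ball z (2 * r)" using that(1) dist_triangle[of z u z'] by simp
    qed
    then show "ball z' r \<subseteq> S" using r by blast
    show "z' + w * cis \<theta> \<in> S" for \<theta>
    proof -
      have "z' + w * cis \<theta> \<in> ball z' r" using that(2) by (simp add: dist_norm norm_mult)
      then show ?thesis using * r by blast
    qed
  qed fact
  then show "\<exists>r>0. \<forall>z'\<in>ball z r. \<forall>w. cmod w < r \<longrightarrow> submean g z' w" using r(1) by blast
qed

lemma locally_submean_on_const [simp]: "locally_submean_on S (\<lambda>_. c)"
  by (auto simp: locally_submean_on_def submean_def mult.commute intro: exI[of _ 1])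

lemma locally_submean_on_scale:
  assumes "locally_submean_on S g" "c \<ge> 0"
  shows "locally_submean_on S (\<lambda>z. c * g z)"
proof -
  have "submean (\<lambda>z. c * g z) z w" if "submean g z w" for z w
    using mult_left_mono[OF that[unfolded submean_def] assms(2)] by (simp add: submean_def algebra_simps)
  then show ?thesis using assms(1) unfolding locally_submean_on_def by blast
qed

lemma locally_submean_on_ln_norm:
  assumes "open S" "F holomorphic_on S" "\<And>u. u \<in> S \<Longrightarrow> F u \<noteq> 0"
  shows "locally_submean_on S (\<lambda>u. ln (cmod (F u)))"
proof (rule locally_submean_onI[OF assms(1), where P = "\<lambda>_ _. True"])
  fix z' r w assume "ball z' r \<subseteq> S" "cmod w < r"
  then show "submean (\<lambda>u. ln (cmod (F u))) z' w"
    using assms by (intro submean_ln_norm[of F z' r]) (auto elim: holomorphic_on_subset)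
qed (auto intro: exI[of _ 1])

text \<open>At each centre the maximum equals one of the two functions, and that one is a minorant
  touching it there.\<close>

lemma locally_submean_on_max:
  assumes S: "open S" and g: "continuous_on S g" "locally_submean_on S g"
    and k: "continuous_on S k" "locally_submean_on S k"
    and f: "\<And>z. z \<in> S \<Longrightarrow> f z = max (g z) (k z)"
  shows "locally_submean_on S f"
proof -
  define P where "P z r \<longleftrightarrow> (\<forall>z'\<in>ball z r. \<forall>w. cmod w < r \<longrightarrow> submean g z' w)
    \<and> (\<forall>z'\<in>ball z r. \<forall>w. cmod w < r \<longrightarrow> submean k z' w)" for z r
  have mono: "P z s" if "P z r" "0 < s" "s \<le> r" for z r s using that by (auto simp: P_def)
  have ex: "\<exists>r>0. P z r" if z: "z \<in> S" for z
  proof -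
    obtain r s where "r > 0" "\<forall>z'\<in>ball z r. \<forall>w. cmod w < r \<longrightarrow> submean g z' w"
        "s > 0" "\<forall>z'\<in>ball z s. \<forall>w. cmod w < s \<longrightarrow> submean k z' w"
      using g(2) k(2) z unfolding locally_submean_on_def by meson
    then show ?thesis by (intro exI[of _ "min r s"]) (auto simp: P_def)
  qed
  have f': "continuous_on S f"
    using continuous_on_max[OF g(1) k(1)] by (rule continuous_on_cong[THEN iffD1, rotated -1]) (auto simp: f)
  show ?thesis
  proof (rule locally_submean_onI[OF S _ ex mono])
    fix z r z' w
    assume z': "z' \<in> ball z r" and w: "cmod w < r" and b: "ball z' r \<subseteq> S"
      and c: "\<And>\<theta>. z' + w * cis \<theta> \<in> S" and P: "P z r"
    have "z' \<in> S" using b norm_ge_zero[of w] w by (auto simp: subset_iff simp del: norm_ge_zero)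
    then have "f z' = g z' \<or> f z' = k z'" by (simp add: f max_def)
    then consider "f z' = g z'" | "f z' = k z'" by blast
    then show "submean f z' w"
    proof cases
      case 1
      then show ?thesis using P z' w
        by (intro submean_lower[OF f' g(1) c]) (auto simp: f P_def)
    next
      case 2
      then show ?thesis using P z' w
        by (intro submean_lower[OF f' k(1) c]) (auto simp: f P_def)
    qed
  qed
qed

lemma locally_submean_on_cong:
  assumes "open S" "continuous_on S k" "locally_submean_on S k" "\<And>z. z \<in> S \<Longrightarrow> g z = k z"
  shows "locally_submean_on S g"
  by (rule locally_submean_on_max[OF assms(1,2,3,2,3)]) (simp add: assms(4))

text \<open>The class is wider than the truncated logarithms of interest, so that logarithmic poles
  can be glued in. Vanishing off a closed \<open>U\<close> inside \<open>W\<close> lets survival in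
  \<open>U\<close> at dyadic times replace the exit time from \<open>W\<close>; the growth bound is
  the logarithm of the one allowed for \<open>f\<close>.\<close>

definition admissible :: "complex set \<Rightarrow> real \<Rightarrow> (complex \<Rightarrow> real) \<Rightarrow> bool" where
  "admissible W p g \<longleftrightarrow> continuous_on UNIV g \<and> (\<forall>z. 0 \<le> g z) \<and> locally_submean_on UNIV g \<and>
    (\<exists>U. closed U \<and> U \<subseteq> W \<and> (\<forall>z. z \<notin> U \<longrightarrow> g z = 0)) \<and>
    (\<exists>D. \<forall>z. g z \<le> D * (1 + cmod z powr (2 * p)))"

text \<open>Zeros of \<open>f\<close> cause no trouble: since \<open>L > 0\<close> they lie off
  \<open>U\<close>, where the function is identically \<open>0\<close>, and away from them it is the
  maximum of \<open>0\<close> and \<open>ln (cmod (f z / L))\<close>. The strict limsup bound makes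
  \<open>U\<close> closed in the plane and not just in \<open>W\<close>.\<close>

lemma admissible_ln_norm:
  fixes f :: "complex \<Rightarrow> complex"
  assumes W: "open W" and f: "f holomorphic_on W"
    and lim: "\<And>\<zeta>. \<zeta> \<in> frontier W \<Longrightarrow> Limsup (at \<zeta> within W) (\<lambda>z. ereal (cmod (f z))) < ereal L"
    and C: "C > 0" and growth: "\<And>z. z \<in> W \<Longrightarrow> cmod (f z) \<le> C * exp (C * cmod z powr (2 * p)) + C"
    and L: "L > 0"
  shows "admissible W p (\<lambda>z. if z \<in> W then ln (max 1 (cmod (f z) / L)) else 0)" (is "admissible W p ?g")
proof -
  define U where "U = {z \<in> W. L \<le> cmod (f z)}"
  have cf: "continuous_on W f" using f by (rule holomorphic_on_imp_continuous_on)
  have "closed U"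
    unfolding closure_subset_eq[symmetric]
  proof
    fix x assume x: "x \<in> closure U"
    show "x \<in> U"
    proof (cases "x \<in> W")
      case True
      have "closedin (top_of_set W) (W \<inter> (\<lambda>z. cmod (f z)) -` {L..})"
        by (intro continuous_closedin_preimage continuous_intros cf)
      moreover have "W \<inter> (\<lambda>z. cmod (f z)) -` {L..} = U" by (auto simp: U_def)
      ultimately have "closedin (top_of_set W) U" by (simp only:)
      then obtain T where T: "closed T" "U = W \<inter> T" unfolding closedin_closed by blast
      then have "x \<in> T" using x closure_minimal[of U T] by auto
      then show ?thesis using T True by simp
    next
      case False
      have "x \<in> closure W" using x closure_mono[of U W] by (auto simp: U_def)
      with False W have "x \<in> frontier W" by (simp add: frontier_def interior_open)
      then have "\<forall>\<^sub>F z in at x within W. cmod (f z) < L"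
        using Limsup_lessD[OF lim[of x]] by simp
      then obtain d where d: "d > 0" "\<And>z. z \<in> W \<Longrightarrow> z \<noteq> x \<Longrightarrow> dist z x < d \<Longrightarrow> cmod (f z) < L"
        by (auto simp: eventually_at)
      obtain z where "z \<in> U" "dist z x < d" using x d(1) by (auto simp: closure_approachable)
      then show ?thesis using d(2)[of z] False by (auto simp: U_def)
    qed
  qed
  have zero: "?g z = 0" if "z \<notin> U" for z
    using that L by (auto simp: U_def max_def field_simps)
  have "continuous_on (W \<union> - U) ?g"
  proof (rule continuous_on_open_Un)
    have "continuous_on W (\<lambda>z. ln (max 1 (cmod (f z) / L)))"
      by (intro continuous_intros cf) (use L in \<open>auto simp: max_def\<close>)
    then show "continuous_on W ?g" by (rule continuous_on_cong[THEN iffD1, rotated -1]) auto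
    have "continuous_on (- U) (\<lambda>_. 0 :: real)" by simp
    then show "continuous_on (- U) ?g" using zero
      by (subst continuous_on_cong[OF refl, of _ _ "\<lambda>_. 0"]) auto
  qed (use W \<open>closed U\<close> in auto)
  moreover have "W \<union> - U = UNIV" by (auto simp: U_def)
  ultimately have cont: "continuous_on UNIV ?g" by simp
  define T where "T = {z \<in> W. f z \<noteq> 0}"
  have T: "open T"
    using continuous_open_preimage[OF cf W, of "- {0}"]
    by (auto simp: T_def vimage_def Int_def)
  have "locally_submean_on T ?g"
  proof (rule locally_submean_on_max[OF T, where g = "\<lambda>_. 0" and k = "\<lambda>z. ln (cmod (f z / of_real L))"])
    have "(\<lambda>z. f z / of_real L) holomorphic_on T"
      using L f by (intro holomorphic_intros) (auto simp: T_def elim: holomorphic_on_subset)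
    then show "locally_submean_on T (\<lambda>z. ln (cmod (f z / of_real L)))"
      using L T by (intro locally_submean_on_ln_norm) (auto simp: T_def)
    have "continuous_on T f" by (rule continuous_on_subset[OF cf]) (auto simp: T_def)
    then show "continuous_on T (\<lambda>z. ln (cmod (f z / of_real L)))"
      using L by (intro continuous_intros) (auto simp: T_def)
    show "?g z = max 0 (ln (cmod (f z / of_real L)))" if "z \<in> T" for z
    proof -
      have "ln (max 1 x) = max 0 (ln x)" if "x > 0" for x :: real using that by (simp add: max_def)
      from this[of "cmod (f z / of_real L)"] show ?thesis
        using that L by (simp add: T_def norm_divide)
    qed
  qed auto
  moreover have "locally_submean_on (- U) ?g"
  proof (rule locally_submean_on_cong[where k = "\<lambda>_. 0"])
    show "open (- U)" using \<open>closed U\<close> by auto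
    show "?g z = 0" if "z \<in> - U" for z by (rule zero) (use that in simp)
  qed simp_all
  ultimately have "locally_submean_on (T \<union> - U) ?g" by (rule locally_submean_on_Un)
  moreover have "T \<union> - U = UNIV" using L by (auto simp: T_def U_def)
  ultimately have sub: "locally_submean_on UNIV ?g" by simp
  \<comment> \<open>The bound \<open>C * exp x + C <= 2 * C * exp x\<close> for
    \<open>x >= 0\<close> explains \<open>2 * C / L\<close>; the maximum with \<open>1\<close> makes
    \<open>ln A\<close> nonnegative and absorbs the \<open>1\<close> inside the truncated
    logarithm.\<close>
  define A where "A = max 1 (2 * C / L)"
  have "?g z \<le> (ln A + C) * (1 + cmod z powr (2 * p))" for z
  proof -
    let ?s = "cmod z powr (2 * p)"
    have A: "A \<ge> 1" "2 * C / L \<le> A" by (auto simp: A_def)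
    have "?g z \<le> ln A + C * ?s"
    proof (cases "z \<in> W")
      case True
      have e: "1 \<le> exp (C * ?s)" using C by simp
      have "C * 1 \<le> C * exp (C * ?s)" using C e by (intro mult_left_mono) auto
      then have "cmod (f z) \<le> 2 * C * exp (C * ?s)"
        using growth[OF True] by linarith
      then have "cmod (f z) / L \<le> 2 * C / L * exp (C * ?s)"
        using L by (simp add: field_simps)
      also have "\<dots> \<le> A * exp (C * ?s)" using A by (intro mult_right_mono) auto
      finally have "max 1 (cmod (f z) / L) \<le> A * exp (C * ?s)"
        using mult_mono[OF A(1) e] A by simp
      then have "ln (max 1 (cmod (f z) / L)) \<le> ln (A * exp (C * ?s))"
        by (subst ln_le_cancel_iff) (use A in auto)
      also have "\<dots> = ln A + C * ?s" using A by (subst ln_mult) auto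
      finally show ?thesis using True by simp
    next
      case False
      then show ?thesis using A C by simp
    qed
    also have "\<dots> \<le> (ln A + C) * (1 + ?s)"
      using A C by (simp add: algebra_simps)
    finally show ?thesis .
  qed
  then have "\<exists>D. \<forall>z. ?g z \<le> D * (1 + cmod z powr (2 * p))" by blast
  moreover have "\<exists>U. closed U \<and> U \<subseteq> W \<and> (\<forall>z. z \<notin> U \<longrightarrow> ?g z = 0)"
    using \<open>closed U\<close> zero by (intro exI[of _ U]) (auto simp: U_def)
  moreover have "\<forall>z. 0 \<le> ?g z" by simp
  ultimately show ?thesis using cont sub unfolding admissible_def by blast
qed

text \<open>A small multiple of the logarithmic pole \<open>ln (\<rho> / |z - z\<^sub>1|)\<close> can be glued to \<open>g\<close>: near
  \<open>z\<^sub>1\<close> it stays below \<open>g\<close>, outside the disc it is negative.\<close>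

lemma admissible_spread:
  assumes g: "admissible W p g" and z: "g z > 0" "\<rho> > 0" "cball z \<rho> \<subseteq> W" and a: "a \<in> ball z \<rho>"
  shows "\<exists>k. admissible W p k \<and> k a > 0"
proof -
  obtain U D where cont: "continuous_on UNIV g" and nonneg: "\<And>z. 0 \<le> g z"
    and sub: "locally_submean_on UNIV g" and U: "closed U" "U \<subseteq> W" "\<And>z. z \<notin> U \<Longrightarrow> g z = 0"
    and D: "\<And>z. g z \<le> D * (1 + cmod z powr (2 * p))"
    using g unfolding admissible_def by blast
  define c where "c = g z / 2"
  have c: "c > 0" "c < g z" using z by (auto simp: c_def)
  have "\<forall>\<^sub>F u in at z. c < g u"
    using cont c(2) by (intro order_tendstoD(1)[where y = "g z"])
      (auto simp: continuous_on_eq_continuous_at isCont_def)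
  then obtain d where d: "d > 0" "\<And>u. dist u z < d \<Longrightarrow> c < g u"
    using c(2) by (auto simp: eventually_at) (metis dist_self)
  define \<delta> where "\<delta> = min d \<rho> / 2"
  have \<delta>: "\<delta> > 0" "\<delta> < d" "\<delta> < \<rho>" using d z by (auto simp: \<delta>_def)
  \<comment> \<open>The scale makes the peak value
    \<open>\<epsilon> * ln (\<rho> / \<delta>)\<close> equal to \<open>c / 2\<close>, hence smaller
    than \<open>g\<close> throughout \<open>ball z d\<close>.\<close>
  define \<epsilon> where "\<epsilon> = c / (2 * ln (\<rho> / \<delta>))"
  have lnpos: "ln (\<rho> / \<delta>) > 0" using \<delta> by simp
  have \<epsilon>: "\<epsilon> > 0" "\<epsilon> * ln (\<rho> / \<delta>) < c" using c lnpos by (auto simp: \<epsilon>_def)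
  \<comment> \<open>Cutting the pole off at radius \<open>\<delta>\<close> keeps
    \<open>\<psi>\<close> continuous. The kink is hidden, since \<open>k = g\<close> on
    \<open>ball z d\<close> and \<open>\<delta> < d\<close>.\<close>
  define \<psi> where "\<psi> u = \<epsilon> * ln (\<rho> / max \<delta> (cmod (u - z)))" for u
  define k where "k u = max (g u) (\<psi> u)" for u
  have mx: "max \<delta> (cmod (u - z)) > 0" for u using \<delta> by (simp add: less_max_iff_disj)
  have \<psi>_le: "\<psi> u \<le> \<epsilon> * ln (\<rho> / \<delta>)" for u
    unfolding \<psi>_def using \<epsilon> \<delta> z mx[of u]
    by (intro mult_left_mono) (auto simp: ln_le_cancel_iff intro!: divide_left_mono mult_pos_pos)
  have c\<psi>: "continuous_on UNIV \<psi>"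
    unfolding \<psi>_def[abs_def] using mx z
    by (intro continuous_intros) (auto simp: less_imp_neq[THEN not_sym])
  have ck: "continuous_on UNIV k" unfolding k_def[abs_def] by (intro continuous_intros cont c\<psi>)
  have "locally_submean_on (ball z d) k"
  proof (rule locally_submean_on_cong[where k = g])
    show "k u = g u" if "u \<in> ball z d" for u
      using d(2)[of u] \<psi>_le[of u] \<epsilon>(2) that by (simp add: k_def dist_commute)
  qed (use cont sub in \<open>auto simp: locally_submean_on_def intro: continuous_on_subset\<close>)
  moreover have "locally_submean_on (- cball z \<delta>) k"
  proof (rule locally_submean_on_max[where g = g and k = "\<lambda>u. \<epsilon> * ln (cmod (of_real \<rho> / (u - z)))"])
    let ?l = "\<lambda>u. \<epsilon> * ln (cmod (of_real \<rho> / (u - z)))"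
    have nz: "u - z \<noteq> 0" if "u \<in> - cball z \<delta>" for u using that \<delta> by auto
    show "locally_submean_on (- cball z \<delta>) ?l"
      using \<epsilon> nz z by (intro locally_submean_on_scale locally_submean_on_ln_norm holomorphic_intros) auto
    show "continuous_on (- cball z \<delta>) ?l"
      using nz z by (intro continuous_intros) auto
    show "k u = max (g u) (?l u)" if "u \<in> - cball z \<delta>" for u
      using that z by (simp add: k_def \<psi>_def norm_divide dist_norm norm_minus_commute max_def)
  qed (use cont sub in \<open>auto simp: locally_submean_on_def intro: continuous_on_subset\<close>)
  ultimately have "locally_submean_on (ball z d \<union> - cball z \<delta>) k" by (rule locally_submean_on_Un)
  moreover have "ball z d \<union> - cball z \<delta> = UNIV" using \<delta> by auto
  ultimately have sk: "locally_submean_on UNIV k" by simp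
  have out: "k u = 0" if "u \<notin> U \<union> cball z \<rho>" for u
  proof -
    have "\<rho> < cmod (u - z)" using that by (simp add: dist_norm norm_minus_commute)
    then have "\<rho> / max \<delta> (cmod (u - z)) \<le> 1" "\<rho> / max \<delta> (cmod (u - z)) > 0"
      using mx[of u] z by (auto simp: field_simps)
    then have "\<psi> u \<le> 0" using \<epsilon> by (simp add: \<psi>_def mult_le_0_iff)
    then show ?thesis using U(3) that by (simp add: k_def)
  qed
  have "k u \<le> (D + c) * (1 + cmod u powr (2 * p))" for u
  proof -
    have "0 \<le> D * (1 + cmod u powr (2 * p))" using nonneg[of u] D[of u] by linarith
    then have "k u \<le> D * (1 + cmod u powr (2 * p)) + c"
      using D[of u] \<psi>_le[of u] \<epsilon>(2) c by (simp add: k_def)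
    also have "\<dots> \<le> (D + c) * (1 + cmod u powr (2 * p))"
      using c by (simp add: algebra_simps)
    finally show ?thesis .
  qed
  then have "\<exists>D. \<forall>u. k u \<le> D * (1 + cmod u powr (2 * p))" by blast
  moreover have "\<exists>U. closed U \<and> U \<subseteq> W \<and> (\<forall>z. z \<notin> U \<longrightarrow> k z = 0)"
    using out U z(3) by (intro exI[of _ "U \<union> cball z \<rho>"]) auto
  moreover have "\<forall>u. 0 \<le> k u" using nonneg by (simp add: k_def le_max_iff_disj)
  ultimately have "admissible W p k" using ck sk unfolding admissible_def by blast
  moreover have "k a > 0"
  proof -
    have "max \<delta> (cmod (a - z)) < \<rho>" using a \<delta> by (simp add: dist_norm norm_minus_commute)
    then have "\<rho> / max \<delta> (cmod (a - z)) > 1" using mx[of a] by simp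
    then have "\<psi> a > 0" using \<epsilon> unfolding \<psi>_def by (intro mult_pos_pos ln_gt_zero)
    then show ?thesis by (simp add: k_def)
  qed
  ultimately show ?thesis by blast
qed

text \<open>One fixed \<open>g\<close> may vanish on an open part of \<open>W\<close>, so the
  connectedness argument is run on the set \<open>N\<close> of points where some admissible function
  is positive.\<close>

lemma admissible_zero_propagates:
  assumes W: "open W" "connected W" "a \<in> W" and a: "\<And>g. admissible W p g \<Longrightarrow> g a = 0"
    and g: "admissible W p g" and z: "z \<in> W"
  shows "g z = 0"
proof -
  define N where "N = {z \<in> W. \<exists>g. admissible W p g \<and> g z > 0}"
  have spread: "ball z \<rho> \<subseteq> N" if "z \<in> N" "\<rho> > 0" "cball z \<rho> \<subseteq> W" for z \<rho>
  proof
    fix u assume u: "u \<in> ball z \<rho>"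
    obtain g where "admissible W p g" "g z > 0" using \<open>z \<in> N\<close> by (auto simp: N_def)
    from admissible_spread[OF this that(2,3) u] show "u \<in> N" using u that(3) by (auto simp: N_def)
  qed
  have "open N"
    unfolding open_contains_ball
  proof
    fix z assume "z \<in> N"
    then obtain \<rho> where "\<rho> > 0" "cball z \<rho> \<subseteq> W" using W by (auto simp: N_def open_contains_cball)
    then show "\<exists>e>0. ball z e \<subseteq> N" using spread \<open>z \<in> N\<close> by blast
  qed
  moreover have "open (W - N)"
    unfolding open_contains_ball
  proof
    fix z assume z: "z \<in> W - N"
    then obtain \<rho> where \<rho>: "\<rho> > 0" "cball z \<rho> \<subseteq> W" using W by (auto simp: open_contains_cball)
    \<comment> \<open>At half the radius the disc about \<open>u\<close> still lies in
      \<open>W\<close> and contains \<open>z\<close>, so \<open>u\<close> in \<open>N\<close> would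
      spread positivity back to \<open>z\<close>.\<close>
    have "u \<notin> N" if "u \<in> ball z (\<rho> / 2)" for u
    proof
      assume u: "u \<in> N"
      have "cball u (\<rho> / 2) \<subseteq> cball z \<rho>"
      proof
        fix v assume "v \<in> cball u (\<rho> / 2)"
        then show "v \<in> cball z \<rho>" using that dist_triangle[of z v u] by simp
      qed
      then have "ball u (\<rho> / 2) \<subseteq> N" using spread[OF u, of "\<rho> / 2"] \<rho> by auto
      then show False using that z by (auto simp: dist_commute)
    qed
    then show "\<exists>e>0. ball z e \<subseteq> W - N"
      using \<rho> by (intro exI[of _ "\<rho> / 2"]) (auto simp: subset_iff)
  qed
  ultimately have "N = {} \<or> W - N = {}"
    using connectedD[OF W(2), of N "W - N"] by (auto simp: N_def)
  moreover have "a \<notin> N" using a by (force simp: N_def)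
  ultimately have "N = {}" using W(3) by auto
  moreover have "g z \<ge> 0" using g by (simp add: admissible_def)
  ultimately show ?thesis using g z by (force simp: N_def)
qed

subsection \<open>Passage times of Brownian motion\<close>

text \<open>Probability that a walk from \<open>x\<close> with step law \<open>N\<close> enters
  \<open>F\<close> within \<open>n\<close> steps, having stayed in \<open>Q\<close> until then,
  written by conditioning on the first step. As a function of \<open>x\<close> it needs no process,
  so bounds can be proved by induction on \<open>n\<close> for all starting points at once.\<close>

primrec hit :: "complex measure \<Rightarrow> complex set \<Rightarrow> complex set \<Rightarrow> nat \<Rightarrow> complex \<Rightarrow> ennreal" where
  "hit N Q F 0 x = indicator F x"
| "hit N Q F (Suc n) x =
    (if x \<in> F then 1 else if x \<in> Q then \<integral>\<^sup>+z. hit N Q F n (x + z) \<partial>N else 0)"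

lemma borel_measurable_hit [measurable]:
  assumes [measurable]: "Q \<in> sets borel" "F \<in> sets borel" and h: "h > 0"
  shows "hit (gauss h) Q F n \<in> borel_measurable borel"
proof (induction n)
  case 0
  have "hit (gauss h) Q F 0 = indicator F" by (simp add: fun_eq_iff)
  then show ?case by simp
next
  case (Suc n)
  interpret prob_space "gauss h" by (rule prob_space_gauss) fact
  note Suc.IH [measurable]
  have "hit (gauss h) Q F (Suc n) = (\<lambda>x. if x \<in> F then 1 else if x \<in> Q
      then \<integral>\<^sup>+z. hit (gauss h) Q F n (x + z) \<partial>gauss h else 0)"
    by (simp add: fun_eq_iff)
  also have "\<dots> \<in> borel_measurable borel" by measurable
  finally show ?case .
qed

lemma hit_le_1:
  assumes h: "h > 0"
  shows "hit (gauss h) Q F n x \<le> 1"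
proof (induction n arbitrary: x)
  case 0
  then show ?case by (simp add: indicator_def)
next
  case (Suc n)
  interpret prob_space "gauss h" by (rule prob_space_gauss) fact
  have "(\<integral>\<^sup>+z. hit (gauss h) Q F n (x + z) \<partial>gauss h) \<le> (\<integral>\<^sup>+z. 1 \<partial>gauss h)"
    by (intro nn_integral_mono Suc)
  then show ?case by (simp add: emeasure_space_1[simplified])
qed

lemma hit_outside: "x \<notin> F \<Longrightarrow> x \<notin> Q \<Longrightarrow> hit N Q F n x = 0"
  by (cases n) auto

lemma hit_inside: "x \<in> F \<Longrightarrow> hit N Q F n x = 1"
  by (cases n) auto

text \<open>The right-hand side is a supermartingale along the walk.\<close>

lemma hit_le_square:
  assumes h: "h > 0" and s: "s > 0"
    and far: "\<And>x. x \<in> F \<Longrightarrow> s \<le> cmod (x - y)"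
  shows "hit (gauss h) Q F n x \<le> ennreal (((cmod (x - y))\<^sup>2 + 8 * real n * h) / s\<^sup>2)"
proof (induction n arbitrary: x)
  case 0
  have "1 \<le> (cmod (x - y))\<^sup>2 / s\<^sup>2" if "x \<in> F"
    using power_mono[OF far[OF that], of 2] s by simp
  then show ?case by (auto simp: indicator_def ennreal_ge_1)
next
  case (Suc n)
  interpret prob_space "gauss h" by (rule prob_space_gauss) fact
  show ?case
  proof (cases "x \<in> F")
    case True
    have "1 \<le> (cmod (x - y))\<^sup>2 / s\<^sup>2" 
      using power_mono[OF far[OF True], of 2] s by simp
    also have "\<dots> \<le> ((cmod (x - y))\<^sup>2 + 8 * real (Suc n) * h) / s\<^sup>2"
      using h by (intro divide_right_mono) auto
    finally show ?thesis using True by (simp add: ennreal_ge_1)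
  next
    case False
    have "(\<integral>\<^sup>+z. hit (gauss h) Q F n (x + z) \<partial>gauss h)
        \<le> (\<integral>\<^sup>+z. ennreal (1 / s\<^sup>2) * (ennreal ((cmod ((x - y) + z))\<^sup>2) + ennreal (8 * real n * h)) \<partial>gauss h)"
    proof (rule nn_integral_mono)
      fix z
      have "((cmod (x + z - y))\<^sup>2 + 8 * real n * h) / s\<^sup>2 = 1 / s\<^sup>2 * ((cmod ((x - y) + z))\<^sup>2 + 8 * real n * h)"
      proof -
        have "x + z - y = (x - y) + z" by simp
        then show ?thesis by (simp only: times_divide_eq_left mult_1_left)
      qed
      then have "ennreal (((cmod (x + z - y))\<^sup>2 + 8 * real n * h) / s\<^sup>2)
          = ennreal (1 / s\<^sup>2) * (ennreal ((cmod ((x - y) + z))\<^sup>2) + ennreal (8 * real n * h))"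
        using h by (simp only: ennreal_mult'' ennreal_plus zero_le_power2 mult_nonneg_nonneg
            add_nonneg_nonneg of_nat_0_le_iff less_imp_le zero_le_numeral)
      then show "hit (gauss h) Q F n (x + z)
          \<le> ennreal (1 / s\<^sup>2) * (ennreal ((cmod ((x - y) + z))\<^sup>2) + ennreal (8 * real n * h))"
        using Suc[of "x + z"] by simp
    qed
    also have "\<dots> = ennreal (1 / s\<^sup>2) * ((\<integral>\<^sup>+z. ennreal ((cmod ((x - y) + z))\<^sup>2) \<partial>gauss h) + ennreal (8 * real n * h))"
      by (subst nn_integral_cmult, simp, subst nn_integral_add)
        (auto simp: emeasure_space_1[simplified])
    also have "\<dots> \<le> ennreal (1 / s\<^sup>2) * (ennreal ((cmod (x - y))\<^sup>2 + 8 * h) + ennreal (8 * real n * h))"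
      by (intro mult_left_mono add_right_mono nn_integral_gauss_shifted_square h) simp
    also have "\<dots> = ennreal (1 / s\<^sup>2 * (((cmod (x - y))\<^sup>2 + 8 * h) + 8 * real n * h))"
      using h by (simp add: ennreal_mult''[symmetric] ennreal_plus[symmetric] del: ennreal_plus)
    also have "1 / s\<^sup>2 * (((cmod (x - y))\<^sup>2 + 8 * h) + 8 * real n * h) = ((cmod (x - y))\<^sup>2 + 8 * real (Suc n) * h) / s\<^sup>2"
      by (simp add: algebra_simps add_divide_distrib)
    finally show ?thesis using False by simp
  qed
qed

text \<open>A good-\<open>\<lambda>\<close> inequality; the last term accounts for steps that overshoot
  the level \<open>r\<close> by more than \<open>r\<close>.\<close>

lemma hit_good_lambda:
  fixes U :: "complex set" and r :: real
  defines "Q \<equiv> \<lambda>r. {z \<in> U. cmod z \<le> r}" and "F \<equiv> \<lambda>r. {z \<in> U. r < cmod z}"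
  assumes U [measurable]: "U \<in> sets borel" and h: "h > 0" and r: "r > 0"
    and t: "real n * h \<le> t" and x: "cmod x \<le> r"
  shows "hit (gauss h) (Q (4 * r)) (F (4 * r)) n x
    \<le> ennreal (2 * t / r\<^sup>2) * hit (gauss h) (Q r) (F r) n x + of_nat n * ennreal (64 * h\<^sup>2 / r ^ 4)"
  using t x
proof (induction n arbitrary: x)
  case 0
  then show ?case using r by (simp add: F_def)
next
  case (Suc n)
  interpret prob_space "gauss h" by (rule prob_space_gauss) fact
  have [measurable]: "Q r \<in> sets borel" "F r \<in> sets borel" for r
    by (simp_all add: Q_def F_def)
  let ?v4 = "hit (gauss h) (Q (4 * r)) (F (4 * r)) n" and ?v = "hit (gauss h) (Q r) (F r) n"
  let ?\<epsilon> = "ennreal (2 * t / r\<^sup>2)" and ?e = "ennreal (64 * h\<^sup>2 / r ^ 4)"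
  have nt: "real n * h \<le> t" using Suc.prems(1) h by (simp add: algebra_simps)
  have [measurable]: "?v \<in> borel_measurable borel" using h by measurable
  show ?case
  proof (cases "x \<in> U")
    case False
    then show ?thesis by (simp add: F_def Q_def)
  next
    case True
    have "(\<integral>\<^sup>+z. ?v4 (x + z) \<partial>gauss h)
      \<le> (\<integral>\<^sup>+z. (?\<epsilon> * ?v (x + z) + of_nat n * ?e) + indicator {z. r < cmod z} z \<partial>gauss h)"
    proof (rule nn_integral_mono)
      fix z
      \<comment> \<open>Case 1 is the induction hypothesis, case 2 kills the walk, case 3 is charged
        to the overshoot error, and only case 4 produces the factor
        \<open>2 * t / r\<^sup>2\<close>.\<close>
      consider "cmod (x + z) \<le> r" | "x + z \<notin> U" | "r < cmod z"
        | "x + z \<in> U" "r < cmod (x + z)" "cmod z \<le> r" by force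
      then show "?v4 (x + z) \<le> (?\<epsilon> * ?v (x + z) + of_nat n * ?e) + indicator {z. r < cmod z} z"
      proof cases
        case 1
        show ?thesis by (rule order_trans[OF Suc.IH[OF nt 1]]) simp
      next
        case 2
        then show ?thesis by (simp add: hit_outside Q_def F_def)
      next
        case 3
        have "?v4 (x + z) \<le> 1" by (rule hit_le_1) fact
        also have "1 \<le> (?\<epsilon> * ?v (x + z) + of_nat n * ?e) + indicator {z. r < cmod z} z"
          using 3 by simp
        finally show ?thesis .
      next
        case 4
        \<comment> \<open>From here level \<open>4 * r\<close> is at distance at least
          \<open>2 * r\<close>; centring \<open>hit_le_square\<close> at the present position leaves
          \<open>8 * n * h / (2 * r)\<^sup>2\<close>, at most \<open>2 * t / r\<^sup>2\<close>.
          Level \<open>r\<close> is already passed, so \<open>?v (x + z) = 1\<close>.\<close>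
        have "cmod (x + z) \<le> 2 * r" using norm_triangle_ineq[of x z] Suc.prems(2) 4 by simp
        then have "2 * r \<le> cmod (u - (x + z))" if "u \<in> F (4 * r)" for u
          using that norm_triangle_ineq2[of u "x + z"] by (simp add: F_def)
        then have "?v4 (x + z) \<le> ennreal (((cmod ((x + z) - (x + z)))\<^sup>2 + 8 * real n * h) / (2 * r)\<^sup>2)"
          using r h by (intro hit_le_square) auto
        also have "\<dots> \<le> ?\<epsilon>"
          using nt r by (intro ennreal_leI) (simp add: power2_eq_square field_simps)
        also have "?\<epsilon> = ?\<epsilon> * ?v (x + z)" using 4 by (simp add: hit_inside F_def)
        finally show ?thesis by (simp add: add_increasing2)
      qed
    qed
    also have "\<dots> = ?\<epsilon> * (\<integral>\<^sup>+z. ?v (x + z) \<partial>gauss h) + of_nat n * ?e + emeasure (gauss h) {z. r < cmod z}"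
      by (subst nn_integral_add, measurable, subst nn_integral_add, measurable, subst nn_integral_cmult, measurable)
        (simp add: emeasure_space_1[simplified])
    also have "\<dots> \<le> ?\<epsilon> * (\<integral>\<^sup>+z. ?v (x + z) \<partial>gauss h) + of_nat n * ?e + ?e"
      by (intro add_left_mono emeasure_gauss_norm_gt h r)
    also have "\<dots> = ?\<epsilon> * (\<integral>\<^sup>+z. ?v (x + z) \<partial>gauss h) + of_nat (Suc n) * ?e"
      by (simp add: distrib_right add.assoc add.commute)
    finally show ?thesis
      using True Suc.prems(2) r by (simp add: F_def Q_def)
  qed
qed

section \<open>Markov property of the sampled path\<close>

context planar_brownian_motion
begin

lemma distr_increment:
  assumes "0 \<le> s" "s < t"
  shows "distr M borel (\<lambda>\<omega>. B t \<omega> - B s \<omega>) = gauss (t - s)"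
proof -
  have "distr M borel (\<lambda>\<omega>. B t \<omega> - B s \<omega>) = distr M lborel (\<lambda>\<omega>. B t \<omega> - B s \<omega>)"
    by (intro distr_cong) auto
  also have "\<dots> = gauss (t - s)"
    using gaussian_increments[OF assms] by (simp add: gauss_def distributed_def)
  finally show ?thesis .
qed

text \<open>This is the Markov property at time \<open>k * h\<close>. The first \<open>k\<close>
  increments and the next one are independent, so their joint law is a product and Fubini integrates
  out the last step.\<close>

lemma nn_integral_markov_step:
  assumes h: "h > 0" and Q [measurable]: "Q \<in> sets borel" and V [measurable]: "V \<in> borel_measurable borel"
  shows "(\<integral>\<^sup>+\<omega>. indicator {\<omega>. \<forall>i\<le>k. B (real i * h) \<omega> \<in> Q} \<omega> * V (B (real (Suc k) * h) \<omega>) \<partial>M)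
    = (\<integral>\<^sup>+\<omega>. indicator {\<omega>. \<forall>i\<le>k. B (real i * h) \<omega> \<in> Q} \<omega>
        * (\<integral>\<^sup>+z. V (B (real k * h) \<omega> + z) \<partial>gauss h) \<partial>M)"
proof -
  interpret G: prob_space "gauss h" by (rule prob_space_gauss) fact
  have [measurable]: "B (real i * h) \<in> borel_measurable M" for i
    using h by (intro measurable_at) simp
  define X where "X i \<omega> = B (real (Suc i) * h) \<omega> - B (real i * h) \<omega>" for i \<omega>
  define P where "P \<omega> = restrict (\<lambda>i. X i \<omega>) {..<k}" for \<omega>
  have mono: "mono_on {..Suc k} (\<lambda>i. real i * h)"
    using h by (intro mono_onI mult_right_mono) auto
  have "indep_vars (\<lambda>_. borel) X {..<Suc k}"
    using independent_increments[of "\<lambda>i. real i * h", OF _ mono]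
    by (simp add: X_def[abs_def])
  then have ind: "indep_var (PiM {..<k} (\<lambda>_. borel)) P (PiM {k} (\<lambda>_. borel)) (\<lambda>\<omega>. restrict (\<lambda>i. X i \<omega>) {k})"
    unfolding P_def[abs_def] by (rule indep_var_restrict) auto
  define Y where "Y \<omega> = restrict (\<lambda>i. X i \<omega>) {k}" for \<omega>
  have Xk: "distr M borel (X k) = gauss h"
    using distr_increment[of "real k * h" "real (Suc k) * h"] h
    by (simp add: X_def[abs_def] algebra_simps)
  have P [measurable]: "P \<in> measurable M (PiM {..<k} (\<lambda>_. borel))"
    and Y [measurable]: "Y \<in> measurable M (PiM {k} (\<lambda>_. borel))"
    and joint: "distr M (PiM {..<k} (\<lambda>_. borel)) P \<Otimes>\<^sub>M distr M (PiM {k} (\<lambda>_. borel)) Y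
      = distr M (PiM {..<k} (\<lambda>_. borel) \<Otimes>\<^sub>M PiM {k} (\<lambda>_. borel)) (\<lambda>\<omega>. (P \<omega>, Y \<omega>))"
    using ind unfolding indep_var_distribution_eq Y_def[abs_def] by auto
  have [measurable]: "X k \<in> borel_measurable M" unfolding X_def[abs_def] by measurable
  interpret Y: prob_space "distr M (PiM {k} (\<lambda>_. borel)) Y" by (rule prob_space_distr) fact
  have Yk: "Y \<omega> k = X k \<omega>" for \<omega> by (simp add: Y_def)
  have Y_int: "(\<integral>\<^sup>+q. \<phi> (q k) \<partial>distr M (PiM {k} (\<lambda>_. borel)) Y) = (\<integral>\<^sup>+z. \<phi> z \<partial>gauss h)"
    if [measurable]: "\<phi> \<in> borel_measurable borel" for \<phi> :: "complex \<Rightarrow> ennreal"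
    unfolding Xk[symmetric] by (simp add: nn_integral_distr Y_def)
  \<comment> \<open>Positions are rebuilt from increments with the deterministic start
    \<open>a\<close>; they agree with the path where \<open>B 0 \<omega> = a\<close>, that is,
    almost surely.\<close>
  define s where "s i p = a + (\<Sum>l<i. p l)" for i and p :: "nat \<Rightarrow> complex"
  have s [measurable]: "s i \<in> borel_measurable (PiM {..<k} (\<lambda>_. borel))" if "i \<le> k" for i
    unfolding s_def[abs_def] using that by (intro borel_measurable_add borel_measurable_sum) auto
  define H where "H p = (indicator {p. \<forall>i\<le>k. s i p \<in> Q} p :: ennreal)" for p
  have H [measurable]: "H \<in> borel_measurable (PiM {..<k} (\<lambda>_. borel))"
  proof -
    have "H = (\<lambda>p. \<Prod>i\<le>k. indicator Q (s i p))"
      by (auto simp: H_def fun_eq_iff indicator_def)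
    then show ?thesis using s by simp
  qed
  have sk [measurable]: "s k \<in> borel_measurable (PiM {..<k} (\<lambda>_. borel))" by (rule s) simp
  have s_eq: "s i (P \<omega>) = B (real i * h) \<omega>" if "i \<le> k" "B 0 \<omega> = a" for i \<omega>
  proof -
    have "s i (P \<omega>) = a + (\<Sum>l<i. X l \<omega>)" using that by (simp add: s_def P_def)
    also have "(\<Sum>l<i. X l \<omega>) = B (real i * h) \<omega> - B (real 0 * h) \<omega>"
      unfolding X_def by (rule sum_lessThan_telescope)
    finally show ?thesis using that by simp
  qed
  have H_eq: "indicator {\<omega>. \<forall>i\<le>k. B (real i * h) \<omega> \<in> Q} \<omega> = H (P \<omega>)" if "B 0 \<omega> = a" for \<omega>
    using s_eq[OF _ that] by (auto simp: H_def indicator_def)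
  have "(\<integral>\<^sup>+\<omega>. indicator {\<omega>. \<forall>i\<le>k. B (real i * h) \<omega> \<in> Q} \<omega> * V (B (real (Suc k) * h) \<omega>) \<partial>M)
      = (\<integral>\<^sup>+\<omega>. H (P \<omega>) * V (s k (P \<omega>) + X k \<omega>) \<partial>M)"
    using start by (intro nn_integral_cong_AE) (auto elim!: eventually_mono simp: H_eq s_eq X_def)
  also have "\<dots> = (\<integral>\<^sup>+w. H (fst w) * V (s k (fst w) + snd w k)
      \<partial>distr M (PiM {..<k} (\<lambda>_. borel) \<Otimes>\<^sub>M PiM {k} (\<lambda>_. borel)) (\<lambda>\<omega>. (P \<omega>, Y \<omega>)))"
    by (subst nn_integral_distr) (auto simp: Yk)
  also have "\<dots> = (\<integral>\<^sup>+p. \<integral>\<^sup>+q. H p * V (s k p + q k)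
      \<partial>distr M (PiM {k} (\<lambda>_. borel)) Y \<partial>distr M (PiM {..<k} (\<lambda>_. borel)) P)"
    unfolding joint[symmetric] by (subst Y.nn_integral_fst[symmetric]) auto
  also have "\<dots> = (\<integral>\<^sup>+p. \<integral>\<^sup>+z. H p * V (s k p + z) \<partial>gauss h \<partial>distr M (PiM {..<k} (\<lambda>_. borel)) P)"
    by (intro nn_integral_cong Y_int) auto
  also have "\<dots> = (\<integral>\<^sup>+\<omega>. \<integral>\<^sup>+z. H (P \<omega>) * V (s k (P \<omega>) + z) \<partial>gauss h \<partial>M)"
    by (subst nn_integral_distr) auto
  also have "\<dots> = (\<integral>\<^sup>+\<omega>. H (P \<omega>) * (\<integral>\<^sup>+z. V (s k (P \<omega>) + z) \<partial>gauss h) \<partial>M)"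
    by (intro nn_integral_cong nn_integral_cmult) auto
  also have "\<dots> = (\<integral>\<^sup>+\<omega>. indicator {\<omega>. \<forall>i\<le>k. B (real i * h) \<omega> \<in> Q} \<omega>
        * (\<integral>\<^sup>+z. V (B (real k * h) \<omega> + z) \<partial>gauss h) \<partial>M)"
    using start by (intro nn_integral_cong_AE) (auto elim!: eventually_mono simp: H_eq s_eq)
  finally show ?thesis .
qed

text \<open>The recursion of \<open>hit\<close> is unrolled along the path, one Markov step at a
  time; this transfers the analytic bounds to Brownian motion.\<close>

lemma emeasure_first_passage:
  assumes h: "h > 0" and [measurable]: "Q \<in> sets borel" "F \<in> sets borel" and disj: "Q \<inter> F = {}"
  shows "emeasure M {\<omega> \<in> space M. \<exists>k\<le>n. (\<forall>i<k. B (real i * h) \<omega> \<in> Q) \<and> B (real k * h) \<omega> \<in> F}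
    = hit (gauss h) Q F n a"
proof -
  have [measurable]: "B (real i * h) \<in> borel_measurable M" for i
    using h by (intro measurable_at) simp
  have [measurable]: "hit (gauss h) Q F n \<in> borel_measurable borel" for n using h by measurable
  let ?S = "\<lambda>i \<omega>. B (real i * h) \<omega>"
  define G where "G k = {\<omega> \<in> space M. (\<forall>i<k. ?S i \<omega> \<in> Q) \<and> ?S k \<omega> \<in> F}" for k
  have [measurable]: "G k \<in> sets M" for k unfolding G_def by measurable
  define J where "J k \<omega> = (indicator {\<omega>. \<forall>i<k. ?S i \<omega> \<in> Q} \<omega> :: ennreal)" for k \<omega>
  have [measurable]: "J k \<in> borel_measurable M" for k
  proof -
    have "J k = (\<lambda>\<omega>. \<Prod>i<k. indicator Q (?S i \<omega>))"
      by (auto simp: J_def fun_eq_iff indicator_def)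
    then show ?thesis by simp
  qed
  have JS: "J (Suc k) \<omega> = indicator {\<omega>. \<forall>i\<le>k. ?S i \<omega> \<in> Q} \<omega>" for k \<omega>
    by (simp add: J_def less_Suc_eq_le)
  \<comment> \<open>Invariant: the passages made before step \<open>k\<close>, plus the expected
    hitting value with \<open>n - k\<close> steps left on paths still in \<open>Q\<close>.\<close>
  have "hit (gauss h) Q F n a = (\<Sum>j<k. emeasure M (G j))
      + (\<integral>\<^sup>+\<omega>. J k \<omega> * hit (gauss h) Q F (n - k) (?S k \<omega>) \<partial>M)" if "k \<le> n" for k
    using that
  proof (induction k)
    case 0
    have "(\<integral>\<^sup>+\<omega>. J 0 \<omega> * hit (gauss h) Q F n (?S 0 \<omega>) \<partial>M) = (\<integral>\<^sup>+\<omega>. hit (gauss h) Q F n a \<partial>M)"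
      using start by (intro nn_integral_cong_AE) (auto elim!: eventually_mono simp: J_def)
    then show ?case by (simp add: emeasure_space_1)
  next
    case (Suc k)
    define m where "m = n - Suc k"
    have nk: "n - k = Suc m" using Suc.prems by (simp add: m_def)
    interpret gp: prob_space "gauss h" by (rule prob_space_gauss) fact
    have "(\<integral>\<^sup>+\<omega>. J k \<omega> * hit (gauss h) Q F (Suc m) (?S k \<omega>) \<partial>M)
      = (\<integral>\<^sup>+\<omega>. indicator (G k) \<omega> + J (Suc k) \<omega> * (\<integral>\<^sup>+z. hit (gauss h) Q F m (?S k \<omega> + z) \<partial>gauss h) \<partial>M)"
      using disj by (intro nn_integral_cong) (auto simp: J_def G_def indicator_def less_Suc_eq)
    also have "\<dots> = emeasure M (G k)
        + (\<integral>\<^sup>+\<omega>. J (Suc k) \<omega> * (\<integral>\<^sup>+z. hit (gauss h) Q F m (?S k \<omega> + z) \<partial>gauss h) \<partial>M)"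
      by (subst nn_integral_add) auto
    also have "(\<integral>\<^sup>+\<omega>. J (Suc k) \<omega> * (\<integral>\<^sup>+z. hit (gauss h) Q F m (?S k \<omega> + z) \<partial>gauss h) \<partial>M)
        = (\<integral>\<^sup>+\<omega>. J (Suc k) \<omega> * hit (gauss h) Q F m (?S (Suc k) \<omega>) \<partial>M)"
      unfolding JS by (rule nn_integral_markov_step[OF h, symmetric]) auto
    finally show ?case using Suc by (simp add: nk m_def add.assoc)
  qed
  from this[of n] have "hit (gauss h) Q F n a = (\<Sum>j<n. emeasure M (G j)) + (\<integral>\<^sup>+\<omega>. J n \<omega> * indicator F (?S n \<omega>) \<partial>M)"
    by simp
  also have "(\<integral>\<^sup>+\<omega>. J n \<omega> * indicator F (?S n \<omega>) \<partial>M) = (\<integral>\<^sup>+\<omega>. indicator (G n) \<omega> \<partial>M)"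
    by (intro nn_integral_cong) (auto simp: J_def G_def indicator_def)
  also have "(\<Sum>j<n. emeasure M (G j)) + \<dots> = (\<Sum>j\<le>n. emeasure M (G j))"
    by (simp add: lessThan_Suc_atMost[symmetric])
  also have "\<dots> = emeasure M (\<Union>j\<le>n. G j)"
  proof (rule sum_emeasure)
    have "G i \<inter> G j = {}" if "i < j" for i j using that disj by (auto simp: G_def)
    then show "disjoint_family_on G {..n}"
      unfolding disjoint_family_on_def by (metis Int_commute linorder_less_linear)
  qed auto
  also have "(\<Union>j\<le>n. G j) = {\<omega> \<in> space M. \<exists>k\<le>n. (\<forall>i<k. ?S i \<omega> \<in> Q) \<and> ?S k \<omega> \<in> F}"
    by (auto simp: G_def)
  finally show ?thesis by simp
qed

end

subsection \<open>Survival and growth\<close>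

text \<open>Since \<open>4 powr (2 * p) = c\<close>, the levels \<open>4 ^ k\<close> have weights
  \<open>c ^ k\<close>. Above level \<open>4 ^ n\<close> a single layer suffices: the one with
  \<open>b\<close> between \<open>4 ^ (n + j)\<close> and \<open>4 ^ (n + j + 1)\<close>.\<close>

lemma dyadic_layer_bound:
  fixes b p :: real
  assumes p: "p > 0" and b: "b \<ge> 0"
  defines "c \<equiv> 16 powr p"
  shows "ennreal (1 + b powr (2 * p))
    \<le> ennreal (1 + c ^ n) + (\<Sum>j. ennreal (c ^ Suc (n + j)) * indicator {b. 4 ^ (n + j) < b} b)"
proof -
  have c: "(4 ^ k) powr (2 * p) = c ^ k" for k :: nat
  proof -
    have "(4 ^ k) powr (2 * p) = 4 powr (2 * (p * k))"
      by (simp add: powr_powr powr_realpow[symmetric] mult_ac)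
    also have "\<dots> = (4 powr 2) powr (p * k)" by (simp only: powr_powr)
    also have "\<dots> = 16 powr (p * k)" by simp
    also have "\<dots> = c ^ k" by (simp add: c_def powr_powr powr_realpow[symmetric])
    finally show ?thesis .
  qed
  define f where "f j = ennreal (c ^ Suc (n + j)) * indicator {b. 4 ^ (n + j) < b} b" for j
  show ?thesis
  proof (cases "b \<le> 4 ^ n")
    case True
    then have "b powr (2 * p) \<le> c ^ n" unfolding c[symmetric] using p b by (intro powr_mono2) auto
    then have "ennreal (1 + b powr (2 * p)) \<le> ennreal (1 + c ^ n)" by (intro ennreal_leI) simp
    then show ?thesis by (simp add: add_increasing2)
  next
    case False
    define k where "k = (LEAST k. b \<le> 4 ^ (n + k))"
    obtain k0 where "b < 4 ^ k0" using real_arch_pow[of 4 b] by auto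
    also have "(4 :: real) ^ k0 \<le> 4 ^ (n + k0)" by (intro power_increasing) auto
    finally have "b \<le> 4 ^ (n + k0)" by simp
    then have k: "b \<le> 4 ^ (n + k)" unfolding k_def by (rule LeastI)
    then have "k \<noteq> 0" using False by (cases k) auto
    then obtain j where j: "k = Suc j" by (cases k) auto
    then have "\<not> b \<le> 4 ^ (n + j)"
      using not_less_Least[of j "\<lambda>k. b \<le> 4 ^ (n + k)"] by (simp add: k_def)
    moreover have "b powr (2 * p) \<le> c ^ Suc (n + j)"
      unfolding c[symmetric] using p b k j by (intro powr_mono2) auto
    ultimately have "ennreal (b powr (2 * p)) \<le> f j" by (simp add: f_def ennreal_leI)
    also have "f j = sum f {j}" by simp
    also have "\<dots> \<le> (\<Sum>j. f j)" by (rule sum_le_suminf) auto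
    finally have "ennreal 1 + ennreal (b powr (2 * p)) \<le> ennreal (1 + c ^ n) + (\<Sum>j. f j)"
      by (intro add_mono ennreal_leI) (simp_all add: c_def)
    then show ?thesis by (simp add: f_def)
  qed
qed

text \<open>Raise \<open>u / q <= exp (u / q)\<close> to the power \<open>q\<close>. This reduces
  integrability of the growth bound at a fixed time to that of
  \<open>exp (cmod (B t \<omega>))\<close>.\<close>

lemma powr_le_exp:
  fixes u q :: real
  assumes "q > 0" "u \<ge> 0"
  shows "u powr q \<le> q powr q * exp u"
proof -
  have "u / q \<le> exp (u / q)" using exp_ge_add_one_self[of "u / q"] by linarith
  then have "(u / q) powr q \<le> exp (u / q) powr q" using assms by (intro powr_mono2) auto
  also have "\<dots> = exp u" using assms by (simp add: powr_def)
  finally have "q powr q * (u / q) powr q \<le> q powr q * exp u" by (intro mult_left_mono) auto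
  then show ?thesis using assms by (simp add: powr_mult[symmetric])
qed

lemma contraction_tendsto_zero:
  fixes z b :: "nat \<Rightarrow> real"
  assumes z: "\<And>i. 0 \<le> z i" and step: "\<And>i. z (Suc i) \<le> z i / 2 + b i" and b: "b \<longlonglongrightarrow> 0"
  shows "z \<longlonglongrightarrow> 0"
proof (rule LIMSEQ_I)
  fix e :: real assume e: "e > 0"
  \<comment> \<open>Halving and adding \<open>e / 4\<close> fixes \<open>e / 2\<close>, the error
    carried through the induction.\<close>
  obtain N where N: "\<And>i. i \<ge> N \<Longrightarrow> \<bar>b i\<bar> < e / 4" using LIMSEQ_D[OF b, of "e / 4"] e by auto
  have ind: "z (N + k) \<le> z N * (1 / 2) ^ k + e / 2" for k
  proof (induction k)
    case (Suc k)
    show ?case using step[of "N + k"] Suc N[of "N + k"] by simp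
  qed (use e in auto)
  have "(\<lambda>k. z N * (1 / 2) ^ k) \<longlonglongrightarrow> z N * 0" by (intro tendsto_intros LIMSEQ_realpow_zero) auto
  then obtain K where K: "\<And>k. k \<ge> K \<Longrightarrow> \<bar>z N * (1 / 2) ^ k\<bar> < e / 2"
    using LIMSEQ_D[of _ 0 "e / 2"] e by fastforce
  have "norm (z n - 0) < e" if "n \<ge> N + K" for n
  proof -
    have "N + (n - N) = n" "K \<le> n - N" using that by auto
    with ind[of "n - N"] K[of "n - N"] z[of n] show ?thesis by (simp add: abs_less_iff)
  qed
  then show "\<exists>no. \<forall>n\<ge>no. norm (z n - 0) < e" by blast
qed

section \<open>Survival and passage at dyadic times\<close>

context planar_brownian_motion
begin

text \<open>The path is observed at the multiples of \<open>1 / 2 ^ m\<close> up to the time \<open>t\<close>.\<close>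

definition alive :: "complex set \<Rightarrow> nat \<Rightarrow> nat \<Rightarrow> 'w set" where
  "alive U m t = {\<omega> \<in> space M. \<forall>k\<le>t * 2 ^ m. B (real k / 2 ^ m) \<omega> \<in> U}"

definition passed :: "complex set \<Rightarrow> nat \<Rightarrow> nat \<Rightarrow> real \<Rightarrow> 'w set" where
  "passed U m t r = {\<omega> \<in> space M. \<exists>k\<le>t * 2 ^ m.
    (\<forall>i<k. B (real i / 2 ^ m) \<omega> \<in> {z \<in> U. cmod z \<le> r}) \<and> B (real k / 2 ^ m) \<omega> \<in> {z \<in> U. r < cmod z}}"

text \<open>A countable intersection, hence measurable before any continuity is used. On a
  continuous path and for closed \<open>U\<close> it says that the path stays in \<open>U\<close>
  throughout \<open>[0, t]\<close>.\<close>

definition survives :: "complex set \<Rightarrow> nat \<Rightarrow> 'w set" where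
  "survives U t = (\<Inter>m. alive U m t)"

lemma measurable_B_nonneg [measurable]:
  shows "B (real i / 2 ^ m) \<in> borel_measurable M" "B (real t) \<in> borel_measurable M"
  by (intro measurable_at; simp)+

lemma sets_alive [measurable]:
  assumes [measurable]: "U \<in> sets borel"
  shows "alive U m t \<in> sets M"
  unfolding alive_def by measurable

lemma sets_passed [measurable]:
  assumes [measurable]: "U \<in> sets borel"
  shows "passed U m t r \<in> sets M"
  unfolding passed_def by measurable

lemma sets_survives [measurable]:
  assumes [measurable]: "U \<in> sets borel"
  shows "survives U t \<in> sets M"
  unfolding survives_def by (intro sets.countable_INT) auto

lemma decseq_alive: "decseq (\<lambda>m. alive U m t)"
proof (rule decseq_SucI)
  fix m
  have "B (real k / 2 ^ m) \<omega> \<in> U" if "\<forall>k\<le>t * 2 ^ Suc m. B (real k / 2 ^ Suc m) \<omega> \<in> U" "k \<le> t * 2 ^ m" for k \<omega>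
    using that(1)[rule_format, of "2 * k"] that(2) by simp
  then show "alive U (Suc m) t \<subseteq> alive U m t" by (auto simp: alive_def)
qed

lemma survives_antimono: "s \<le> t \<Longrightarrow> survives U t \<subseteq> survives U s"
  by (auto simp: survives_def alive_def intro: order_trans[OF _ mult_right_mono])

lemma prob_alive_tendsto:
  assumes "U \<in> sets borel"
  shows "(\<lambda>m. prob (alive U m t)) \<longlonglongrightarrow> prob (survives U t)"
  unfolding survives_def
  by (rule finite_Lim_measure_decseq) (use assms decseq_alive in auto)

text \<open>Each of the \<open>t * 2 ^ m\<close> steps contributes an overshoot error of order
  \<open>1 / 4 ^ m\<close>, so the total still vanishes as \<open>m\<close> grows.\<close>

lemma prob_passed_good_lambda:
  assumes U: "U \<in> sets borel" and r: "r > 0" "cmod a \<le> r"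
  shows "prob (passed U m t (4 * r)) \<le> 2 * real t / r\<^sup>2 * prob (passed U m t r) + 64 * real t / r ^ 4 / 2 ^ m"
proof -
  define h :: real where "h = 1 / 2 ^ m"
  have h: "h > 0" by (simp add: h_def)
  have disj: "{z \<in> U. cmod z \<le> s} \<inter> {z \<in> U. s < cmod z} = {}" for s by auto
  have eq: "ennreal (prob (passed U m t s)) = hit (gauss h) {z \<in> U. cmod z \<le> s} {z \<in> U. s < cmod z} (t * 2 ^ m) a" for s
    using emeasure_first_passage[of h "{z \<in> U. cmod z \<le> s}" "{z \<in> U. s < cmod z}" "t * 2 ^ m"] U h disj[of s]
    by (simp add: passed_def h_def emeasure_eq_measure)
  have "ennreal (prob (passed U m t (4 * r)))
      \<le> ennreal (2 * real t / r\<^sup>2) * ennreal (prob (passed U m t r)) + of_nat (t * 2 ^ m) * ennreal (64 * h\<^sup>2 / r ^ 4)"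
    unfolding eq by (rule hit_good_lambda) (use U h r in \<open>auto simp: h_def\<close>)
  also have "\<dots> = ennreal (2 * real t / r\<^sup>2 * prob (passed U m t r) + real (t * 2 ^ m) * (64 * h\<^sup>2 / r ^ 4))"
    by (simp add: ennreal_of_nat_eq_real_of_nat ennreal_mult''[symmetric] ennreal_plus[symmetric] del: ennreal_plus)
  also have "real (t * 2 ^ m) * (64 * h\<^sup>2 / r ^ 4) = 64 * real t / r ^ 4 / 2 ^ m"
    by (simp add: h_def power2_eq_square mult.commute)
  finally show ?thesis
    by (subst (asm) ennreal_le_iff) auto
qed

text \<open>A passage after time \<open>s\<close> forces the path to be in \<open>U\<close> at all
  grid times up to \<open>s\<close>. This lets the time horizon be shortened in the recursion for
  \<open>passage_bound\<close>.\<close>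

lemma passed_subset:
  assumes "s \<le> t"
  shows "passed U m t r \<subseteq> passed U m s r \<union> alive U m s"
proof
  fix \<omega> assume "\<omega> \<in> passed U m t r"
  then obtain k where k: "\<omega> \<in> space M" "\<forall>i<k. B (real i / 2 ^ m) \<omega> \<in> {z \<in> U. cmod z \<le> r}"
      "B (real k / 2 ^ m) \<omega> \<in> {z \<in> U. r < cmod z}"
    by (auto simp: passed_def)
  show "\<omega> \<in> passed U m s r \<union> alive U m s"
  proof (cases "k \<le> s * 2 ^ m")
    case True
    then show ?thesis using k by (auto simp: passed_def)
  next
    case False
    then show ?thesis using k by (auto simp: alive_def)
  qed
qed

text \<open>The first grid time at which the path is beyond \<open>r\<close> is a passage. The left
  side does not involve the mesh, so bounds for the right side may be used in the limit of large
  \<open>m\<close>.\<close>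

lemma survives_far_subset: "survives U t \<inter> {\<omega>. r < cmod (B (real t) \<omega>)} \<subseteq> passed U m t r"
proof
  fix \<omega> assume \<omega>: "\<omega> \<in> survives U t \<inter> {\<omega>. r < cmod (B (real t) \<omega>)}"
  define k where "k = (LEAST k. r < cmod (B (real k / 2 ^ m) \<omega>))"
  have "r < cmod (B (real (t * 2 ^ m) / 2 ^ m) \<omega>)" using \<omega> by simp
  then have k: "k \<le> t * 2 ^ m" "r < cmod (B (real k / 2 ^ m) \<omega>)"
    unfolding k_def by (rule Least_le, rule LeastI)
  have "cmod (B (real i / 2 ^ m) \<omega>) \<le> r" if "i < k" for i
    using not_less_Least[of i "\<lambda>k. r < cmod (B (real k / 2 ^ m) \<omega>)"] that by (simp add: k_def)
  then show "\<omega> \<in> passed U m t r" using \<omega> k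
    by (auto simp: survives_def alive_def passed_def intro!: exI[of _ k])
qed

text \<open>A time \<open>s < t\<close> is a limit of dyadic times not exceeding it, at which the
  path is in \<open>U\<close>; continuity and closedness then put \<open>B s \<omega>\<close> in
  \<open>U\<close>. Path continuity enters the whole proof only through this lemma.\<close>

lemma exit_time_ge_if_survives:
  assumes U: "closed U" "U \<subseteq> W" and \<omega>: "\<omega> \<in> survives U t"
    and cont: "continuous_on {0..} (\<lambda>s. B s \<omega>)"
  shows "ennreal (real t) \<le> exit_time W (\<lambda>s. B s \<omega>)"
  unfolding exit_time_def
proof (rule INF_greatest)
  fix s assume "s \<in> {s. 0 \<le> s \<and> B s \<omega> \<notin> W}"
  then have s: "0 \<le> s" "B s \<omega> \<notin> W" by auto
  have "real t \<le> s"
  proof (rule ccontr)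
    assume "\<not> real t \<le> s"
    then have st: "s < real t" by simp
    define d where "d m = real (nat \<lfloor>s * 2 ^ m\<rfloor>) / 2 ^ m" for m :: nat
    have d_le: "d m \<le> s" and d_ge: "s - (1 / 2) ^ m \<le> d m" for m
    proof -
      have fl: "real (nat \<lfloor>s * 2 ^ m\<rfloor>) = of_int \<lfloor>s * 2 ^ m\<rfloor>" using s(1) by simp
      show "d m \<le> s" unfolding d_def fl by (simp add: pos_divide_le_eq)
      have "s * 2 ^ m - 1 \<le> of_int \<lfloor>s * 2 ^ m\<rfloor>" by linarith
      then show "s - (1 / 2) ^ m \<le> d m"
        unfolding d_def fl by (simp add: pos_le_divide_eq left_diff_distrib power_one_over)
    qed
    have "(\<lambda>m. s - (1 / 2) ^ m) \<longlonglongrightarrow> s - 0" by (intro tendsto_intros LIMSEQ_realpow_zero) auto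
    then have "(\<lambda>m. s - (1 / 2) ^ m) \<longlonglongrightarrow> s" by simp
    then have "d \<longlonglongrightarrow> s"
      by (rule tendsto_sandwich[OF always_eventually always_eventually _ tendsto_const, rotated 2])
        (use d_le d_ge in auto)
    then have "(\<lambda>m. B (d m) \<omega>) \<longlonglongrightarrow> B s \<omega>"
      by (rule continuous_on_tendsto_compose[OF cont]) (use s in \<open>auto simp: d_def\<close>)
    moreover have "B (d m) \<omega> \<in> U" for m
    proof -
      have "s * 2 ^ m \<le> real t * 2 ^ m" using st by (intro mult_right_mono) auto
      moreover have "real (nat \<lfloor>s * 2 ^ m\<rfloor>) \<le> s * 2 ^ m"
        using d_le[of m] by (simp add: d_def pos_divide_le_eq)
      ultimately have "real (nat \<lfloor>s * 2 ^ m\<rfloor>) \<le> real t * 2 ^ m" by (rule order_trans[rotated])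
      then have "real (nat \<lfloor>s * 2 ^ m\<rfloor>) \<le> real (t * 2 ^ m)" by (simp only: of_nat_mult of_nat_power of_nat_numeral)
      then have "nat \<lfloor>s * 2 ^ m\<rfloor> \<le> t * 2 ^ m" by (simp only: of_nat_le_iff)
      then show ?thesis using \<omega> by (auto simp: survives_def alive_def d_def)
    qed
    ultimately have "B s \<omega> \<in> U"
      using closed_sequentially[OF U(1), of "\<lambda>m. B (d m) \<omega>" "B s \<omega>"] by simp
    then show False using s U by blast
  qed
  then show "ennreal (real t) \<le> ennreal s" by (rule ennreal_leI)
qed

text \<open>Markov's inequality would only give boundedness. Here all terms lie below one integrable
  function, itself at most the \<open>p\<close>-th power of the exit time, and almost surely they
  are eventually \<open>0\<close>; dominated convergence applies.\<close>

lemma survival_decay: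
  assumes U: "closed U" "U \<subseteq> W" and p: "p > 0" and moment: "exit_time_moment M B W p < \<infinity>"
  shows "(\<lambda>i. (16 powr p) ^ i * prob (survives U (16 ^ i))) \<longlonglongrightarrow> 0"
proof -
  have [measurable]: "U \<in> sets borel" using U(1) by simp
  let ?c = "16 powr p :: real"
  have c: "?c > 1" using p by simp
  let ?u = "\<lambda>i \<omega>. ennreal (?c ^ i) * indicator (survives U (16 ^ i)) \<omega>"
  \<comment> \<open>The supremum stands in for the power of the exit time as dominating function,
    being measurable by construction.\<close>
  define \<Phi> where "\<Phi> \<omega> = (SUP i. ?u i \<omega>)" for \<omega>
  have [measurable]: "\<Phi> \<in> borel_measurable M" unfolding \<Phi>_def[abs_def] by measurable
  have "AE \<omega> in M. \<Phi> \<omega> \<le> ennreal_rpow (exit_time W (\<lambda>t. B t \<omega>)) p"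
    using continuous_paths
  proof eventually_elim
    case (elim \<omega>)
    show ?case
      unfolding \<Phi>_def
    proof (rule SUP_least)
      fix i
      show "?u i \<omega> \<le> ennreal_rpow (exit_time W (\<lambda>t. B t \<omega>)) p"
      proof (cases "\<omega> \<in> survives U (16 ^ i)")
        case True
        let ?T = "exit_time W (\<lambda>t. B t \<omega>)"
        have T: "ennreal (16 ^ i) \<le> ?T"
          using exit_time_ge_if_survives[OF U True elim] by simp
        show ?thesis
        proof (cases "?T = \<infinity>")
          case False
          then have "16 ^ i \<le> enn2real ?T"
            using enn2real_mono[OF T] by (simp add: less_top)
          then have "(16 ^ i) powr p \<le> enn2real ?T powr p" using p by (intro powr_mono2) auto
          also have "(16 ^ i :: real) powr p = ?c ^ i"
            by (simp add: powr_powr powr_realpow[symmetric] mult.commute)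
          finally show ?thesis using False True by (simp add: ennreal_rpow_def ennreal_leI)
        qed (simp add: ennreal_rpow_def)
      qed simp
    qed
  qed
  then have "(\<integral>\<^sup>+\<omega>. \<Phi> \<omega> \<partial>M) \<le> exit_time_moment M B W p"
    unfolding exit_time_moment_def by (rule nn_integral_mono_AE)
  then have fin: "(\<integral>\<^sup>+\<omega>. \<Phi> \<omega> \<partial>M) < \<infinity>" using moment by (rule le_less_trans)
  then have "AE \<omega> in M. \<Phi> \<omega> \<noteq> \<infinity>" by (intro nn_integral_PInf_AE) auto
  then have conv: "AE \<omega> in M. (\<lambda>i. ?u i \<omega>) \<longlonglongrightarrow> 0"
  proof eventually_elim
    case (elim \<omega>)
    have "\<exists>i. \<omega> \<notin> survives U (16 ^ i)"
    proof (rule ccontr)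
      assume "\<not> ?thesis"
      then have "ennreal (?c ^ i) \<le> \<Phi> \<omega>" for i
        unfolding \<Phi>_def by (intro SUP_upper2[of i]) auto
      moreover obtain x where x: "\<Phi> \<omega> = ennreal x" "x \<ge> 0" using elim by (cases "\<Phi> \<omega>") auto
      moreover obtain i where "x < ?c ^ i" using real_arch_pow[OF c] by blast
      ultimately show False by (metis ennreal_le_iff linorder_not_less)
    qed
    then obtain i where i: "\<omega> \<notin> survives U (16 ^ i)" by blast
    have "?u j \<omega> = 0" if "j \<ge> i" for j
      using i survives_antimono[of "16 ^ i" "16 ^ j" U] that
      by (auto simp: power_increasing indicator_def)
    then show ?case by (intro tendsto_eventually) (auto simp: eventually_sequentially)
  qed
  have "(\<lambda>i. \<integral>\<^sup>+\<omega>. ?u i \<omega> \<partial>M) \<longlonglongrightarrow> (\<integral>\<^sup>+\<omega>. 0 \<partial>M)"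
  proof (rule nn_integral_dominated_convergence[where w = \<Phi>])
    show "AE \<omega> in M. ?u i \<omega> \<le> \<Phi> \<omega>" for i
      unfolding \<Phi>_def by (intro AE_I2 SUP_upper) simp
  qed (use fin conv in auto)
  moreover have "(\<integral>\<^sup>+\<omega>. ?u i \<omega> \<partial>M) = ennreal (?c ^ i * prob (survives U (16 ^ i)))" for i
    by (simp add: nn_integral_cmult_indicator emeasure_eq_measure ennreal_mult)
  ultimately show ?thesis by (simp add: ennreal_tendsto_0_iff)
qed

text \<open>The entry \<open>i\<close> bounds, up to an error vanishing with the mesh, the probability of reaching
  the level \<open>4 ^ (i + l)\<close> inside \<open>U\<close> up to time \<open>16 ^ i\<close>, where \<open>\<epsilon> = 2 / 16 ^ l\<close>.\<close>

primrec passage_bound :: "complex set \<Rightarrow> real \<Rightarrow> nat \<Rightarrow> real" where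
  "passage_bound U \<epsilon> 0 = 1"
| "passage_bound U \<epsilon> (Suc i) = \<epsilon> * passage_bound U \<epsilon> i + prob (survives U (16 ^ i))"

lemma passage_bound_nonneg: "\<epsilon> \<ge> 0 \<Longrightarrow> passage_bound U \<epsilon> i \<ge> 0"
  by (induction i) auto

text \<open>At time \<open>16 ^ i\<close> and level \<open>4 ^ (n + l)\<close> with
  \<open>n >= i\<close>, the good-lambda factor is at most \<open>\<epsilon>\<close>. So each extra
  level costs a factor \<open>\<epsilon>\<close>, and shortening the time by a factor 16 costs the
  survival probability. The error \<open>e\<close> may depend on \<open>i\<close> and
  \<open>j\<close>, since only the mesh is refined afterwards.\<close>

lemma prob_passed_le_passage_bound:
  fixes l :: nat
  defines "\<epsilon> \<equiv> 2 / 16 ^ l" and "R \<equiv> \<lambda>i. 4 ^ (i + l)"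
  assumes U [measurable]: "U \<in> sets borel" and a: "cmod a \<le> 4 ^ l"
  shows "\<exists>e. e \<longlonglongrightarrow> 0 \<and>
    (\<forall>m. prob (passed U m (16 ^ i) (R (i + j))) \<le> \<epsilon> ^ j * passage_bound U \<epsilon> i + e m)"
proof -
  have R: "R n > 0" "cmod a \<le> R n" "R (Suc n) = 4 * R n" "(R n)\<^sup>2 = 16 ^ n * 16 ^ l" for n
  proof -
    show "R n > 0" "R (Suc n) = 4 * R n" by (simp_all add: R_def)
    have "(4 :: real) ^ l \<le> R n" by (simp add: R_def power_increasing)
    then show "cmod a \<le> R n" using a by linarith
    have "(R n)\<^sup>2 = (4\<^sup>2) ^ (n + l)" unfolding R_def power_mult[symmetric] by (simp add: mult.commute)
    then show "(R n)\<^sup>2 = 16 ^ n * 16 ^ l" by (simp add: power_add)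
  qed
  have eps: "\<epsilon> \<ge> 0" by (simp add: \<epsilon>_def)
  have err: "(\<lambda>m. x / 2 ^ m) \<longlonglongrightarrow> 0" for x :: real
    by (rule LIMSEQ_divide_realpow_zero) simp
  have step: "prob (passed U m (16 ^ i) (R (Suc n))) \<le> \<epsilon> * prob (passed U m (16 ^ i) (R n))
      + 64 * 16 ^ i / R n ^ 4 / 2 ^ m" if "i \<le> n" for i n m
  proof -
    have "2 * real (16 ^ i) / (R n)\<^sup>2 \<le> \<epsilon>"
      using power_increasing[OF that, of "16 :: real"] by (simp add: R(4) \<epsilon>_def field_simps)
    then have "2 * real (16 ^ i) / (R n)\<^sup>2 * prob (passed U m (16 ^ i) (R n))
        \<le> \<epsilon> * prob (passed U m (16 ^ i) (R n))"
      by (rule mult_right_mono) simp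
    then show ?thesis
      using prob_passed_good_lambda[OF U R(1,2), of m "16 ^ i" n] R(3)[of n] by simp
  qed
  have base: "\<exists>e. e \<longlonglongrightarrow> 0 \<and> (\<forall>m. prob (passed U m (16 ^ i) (R i)) \<le> passage_bound U \<epsilon> i + e m)"
  proof (induction i)
    case 0
    show ?case by (intro exI[of _ "\<lambda>_. 0"]) simp
  next
    case (Suc i)
    then obtain e where e: "e \<longlonglongrightarrow> 0"
        "\<And>m. prob (passed U m (16 ^ i) (R i)) \<le> passage_bound U \<epsilon> i + e m" by blast
    \<comment> \<open>The last summand pays for replacing survival on one mesh by survival on all of
      them.\<close>
    define e' where "e' m = \<epsilon> * e m + 64 * 16 ^ i / R i ^ 4 / 2 ^ m
      + (prob (alive U m (16 ^ i)) - prob (survives U (16 ^ i)))" for m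
    have "e' \<longlonglongrightarrow> \<epsilon> * 0 + 0 + (prob (survives U (16 ^ i)) - prob (survives U (16 ^ i)))"
      unfolding e'_def[abs_def] by (intro tendsto_intros e err prob_alive_tendsto U)
    moreover have "prob (passed U m (16 ^ Suc i) (R (Suc i))) \<le> passage_bound U \<epsilon> (Suc i) + e' m" for m
    proof -
      have "prob (passed U m (16 ^ Suc i) (R (Suc i)))
          \<le> prob (passed U m (16 ^ i) (R (Suc i)) \<union> alive U m (16 ^ i))"
        by (intro finite_measure_mono passed_subset) auto
      also have "\<dots> \<le> prob (passed U m (16 ^ i) (R (Suc i))) + prob (alive U m (16 ^ i))"
        by (rule measure_Un_le) auto
      also have "prob (passed U m (16 ^ i) (R (Suc i)))
          \<le> \<epsilon> * (passage_bound U \<epsilon> i + e m) + 64 * 16 ^ i / R i ^ 4 / 2 ^ m"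
        using step[of i i m] mult_left_mono[OF e(2)[of m] eps] by simp
      finally show ?thesis by (simp add: e'_def algebra_simps)
    qed
    ultimately show ?case by auto
  qed
  show ?thesis
  proof (induction j)
    case 0
    show ?case using base by simp
  next
    case (Suc j)
    then obtain e where e: "e \<longlonglongrightarrow> 0"
        "\<And>m. prob (passed U m (16 ^ i) (R (i + j))) \<le> \<epsilon> ^ j * passage_bound U \<epsilon> i + e m" by blast
    define e' where "e' m = \<epsilon> * e m + 64 * 16 ^ i / R (i + j) ^ 4 / 2 ^ m" for m
    have "e' \<longlonglongrightarrow> \<epsilon> * 0 + 0" unfolding e'_def[abs_def] by (intro tendsto_intros e err)
    moreover have "prob (passed U m (16 ^ i) (R (i + Suc j))) \<le> \<epsilon> ^ Suc j * passage_bound U \<epsilon> i + e' m" for m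
      using step[of i "i + j" m] mult_left_mono[OF e(2)[of m] eps]
      by (simp add: e'_def algebra_simps)
    ultimately show ?case by auto
  qed
qed

lemma prob_survives_far:
  fixes l :: nat
  defines "\<epsilon> \<equiv> 2 / 16 ^ l"
  assumes U [measurable]: "U \<in> sets borel" and a: "cmod a \<le> 4 ^ l"
  shows "prob (survives U (16 ^ i) \<inter> {\<omega>. 4 ^ (i + j + l) < cmod (B (real (16 ^ i)) \<omega>)})
    \<le> \<epsilon> ^ j * passage_bound U \<epsilon> i"
proof -
  obtain e where e: "e \<longlonglongrightarrow> 0"
      "\<And>m. prob (passed U m (16 ^ i) (4 ^ (i + j + l))) \<le> \<epsilon> ^ j * passage_bound U \<epsilon> i + e m"
    using prob_passed_le_passage_bound[OF U a, of i j] unfolding \<epsilon>_def by blast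
  have "(\<lambda>m. \<epsilon> ^ j * passage_bound U \<epsilon> i + e m) \<longlonglongrightarrow> \<epsilon> ^ j * passage_bound U \<epsilon> i + 0"
    by (intro tendsto_intros e)
  moreover have "prob (survives U (16 ^ i) \<inter> {\<omega>. 4 ^ (i + j + l) < cmod (B (real (16 ^ i)) \<omega>)})
      \<le> \<epsilon> ^ j * passage_bound U \<epsilon> i + e m" for m
    by (rule order_trans[OF finite_measure_mono[OF survives_far_subset] e(2)]) simp
  ultimately show ?thesis by (intro LIMSEQ_le_const[of _ _ "prob _"]) auto
qed

section \<open>The submartingale bound and its limit along the times \<open>16 ^ i\<close>\<close>

lemma nn_integral_exp_norm_finite:
  assumes "t > 0"
  shows "(\<integral>\<^sup>+\<omega>. ennreal (exp (cmod (B t \<omega>))) \<partial>M) < \<infinity>"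
proof -
  have [measurable]: "B t \<in> borel_measurable M" "B 0 \<in> borel_measurable M"
    using assms by (auto intro: measurable_at)
  have "(\<integral>\<^sup>+\<omega>. ennreal (exp (cmod (B t \<omega>))) \<partial>M)
      \<le> (\<integral>\<^sup>+\<omega>. ennreal (exp (cmod a)) * ennreal (exp (cmod (B t \<omega> - B 0 \<omega>))) \<partial>M)"
    using start
  proof (intro nn_integral_mono_AE, eventually_elim)
    case (elim \<omega>)
    have "cmod (B t \<omega>) \<le> cmod a + cmod (B t \<omega> - B 0 \<omega>)"
      using norm_triangle_ineq[of a "B t \<omega> - a"] elim by simp
    then show ?case by (simp add: ennreal_mult'[symmetric] exp_add[symmetric])
  qed
  also have "\<dots> = ennreal (exp (cmod a)) * (\<integral>\<^sup>+z. ennreal (exp (cmod z)) \<partial>gauss t)"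
    using distr_increment[of 0 t] assms
    by (simp add: nn_integral_cmult nn_integral_distr flip: distr_increment[of 0 t, simplified])
  also have "\<dots> < \<infinity>"
    using nn_integral_gauss_exp_norm[OF assms] by (simp add: ennreal_mult_less_top)
  finally show ?thesis .
qed

text \<open>Killing outside \<open>U\<close> costs nothing since \<open>g\<close> vanishes there, so
  the submartingale inequality persists under the indicator; this takes the place of optional
  stopping. Refining the mesh then turns \<open>alive\<close> into \<open>survives\<close> by
  dominated convergence.\<close>

lemma admissible_le_survival:
  assumes cont: "continuous_on UNIV g" and nonneg: "\<And>z. 0 \<le> g z" and sub: "locally_submean_on UNIV g"
    and U: "closed U" "\<And>z. z \<notin> U \<Longrightarrow> g z = 0" and t: "t > 0"
    and fin: "(\<integral>\<^sup>+\<omega>. ennreal (g (B (real t) \<omega>)) \<partial>M) < \<infinity>"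
  shows "ennreal (g a) \<le> (\<integral>\<^sup>+\<omega>. indicator (survives U t) \<omega> * ennreal (g (B (real t) \<omega>)) \<partial>M)"
proof -
  have [measurable]: "U \<in> sets borel" using U(1) by simp
  have [measurable]: "g \<in> borel_measurable borel" using cont by (rule borel_measurable_continuous_onI)
  have le: "ennreal (g a) \<le> (\<integral>\<^sup>+\<omega>. indicator (alive U m t) \<omega> * ennreal (g (B (real t) \<omega>)) \<partial>M)" for m
  proof -
    define h :: real where "h = 1 / 2 ^ m"
    have h: "h > 0" by (simp add: h_def)
    let ?I = "\<lambda>k \<omega>. indicator {\<omega>. \<forall>i\<le>k. B (real i * h) \<omega> \<in> U} \<omega> :: ennreal"
    have "ennreal (g a) \<le> (\<integral>\<^sup>+\<omega>. ?I k \<omega> * ennreal (g (B (real k * h) \<omega>)) \<partial>M)" for k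
    proof (induction k)
      case 0
      have "(\<integral>\<^sup>+\<omega>. ?I 0 \<omega> * ennreal (g (B (real 0 * h) \<omega>)) \<partial>M) = (\<integral>\<^sup>+\<omega>. ennreal (g a) \<partial>M)"
        using start
      proof (intro nn_integral_cong_AE, eventually_elim)
        case (elim \<omega>)
        then show ?case using U(2)[of a] by (auto simp: indicator_def)
      qed
      then show ?case by (simp add: emeasure_space_1)
    next
      case (Suc k)
      also have "(\<integral>\<^sup>+\<omega>. ?I k \<omega> * ennreal (g (B (real k * h) \<omega>)) \<partial>M)
          \<le> (\<integral>\<^sup>+\<omega>. ?I k \<omega> * (\<integral>\<^sup>+z. ennreal (g (B (real k * h) \<omega> + z)) \<partial>gauss h) \<partial>M)"
        by (intro nn_integral_mono mult_left_mono gauss_submean cont nonneg sub h) auto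
      also have "\<dots> = (\<integral>\<^sup>+\<omega>. ?I k \<omega> * ennreal (g (B (real (Suc k) * h) \<omega>)) \<partial>M)"
        by (rule nn_integral_markov_step[OF h, symmetric]) auto
      also have "\<dots> = (\<integral>\<^sup>+\<omega>. ?I (Suc k) \<omega> * ennreal (g (B (real (Suc k) * h) \<omega>)) \<partial>M)"
        using U(2) by (intro nn_integral_cong) (auto simp: indicator_def le_Suc_eq)
      finally show ?case .
    qed
    from this[of "t * 2 ^ m"] show ?thesis
      by (rule order_trans) (auto intro!: nn_integral_mono simp: alive_def h_def indicator_def)
  qed
  have "(\<lambda>m. \<integral>\<^sup>+\<omega>. indicator (alive U m t) \<omega> * ennreal (g (B (real t) \<omega>)) \<partial>M)
      \<longlonglongrightarrow> (\<integral>\<^sup>+\<omega>. indicator (survives U t) \<omega> * ennreal (g (B (real t) \<omega>)) \<partial>M)"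
  proof (rule nn_integral_dominated_convergence[OF _ _ _ _ fin])
    show "AE \<omega> in M. (\<lambda>m. indicator (alive U m t) \<omega> * ennreal (g (B (real t) \<omega>)))
        \<longlonglongrightarrow> indicator (survives U t) \<omega> * ennreal (g (B (real t) \<omega>))"
    proof (intro AE_I2)
      fix \<omega>
      have "(\<lambda>m. indicator (alive U m t) \<omega> :: ennreal) \<longlonglongrightarrow> indicator (survives U t) \<omega>"
        unfolding survives_def by (rule LIMSEQ_indicator_decseq[OF decseq_alive])
      then show "(\<lambda>m. indicator (alive U m t) \<omega> * ennreal (g (B (real t) \<omega>)))
          \<longlonglongrightarrow> indicator (survives U t) \<omega> * ennreal (g (B (real t) \<omega>))"
        unfolding mult.commute[of _ "ennreal _"] by (intro ennreal_tendsto_cmult) auto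
    qed
  qed (auto simp: indicator_def)
  then show ?thesis using le by (intro LIMSEQ_le_const) auto
qed

text \<open>Weighting the recursion by powers of \<open>16 powr p\<close> gives the contraction
  factor \<open>16 powr p * (2 / 16 ^ l)\<close>, which \<open>p + 1 \<le> l\<close> makes at most
  \<open>1 / 2\<close>; the remaining term tends to \<open>0\<close> by
  \<open>survival_decay\<close>.\<close>

lemma passage_bound_decay:
  fixes p :: real and l :: nat
  assumes U: "closed U" "U \<subseteq> W" and p: "p > 0" and moment: "exit_time_moment M B W p < \<infinity>"
    and l: "p + 1 \<le> l"
  shows "(\<lambda>i. (16 powr p) ^ i * passage_bound U (2 / 16 ^ l) i) \<longlonglongrightarrow> 0"
proof -
  let ?c = "16 powr p :: real" and ?\<epsilon> = "2 / 16 ^ l :: real"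
  have "?c * 16 = 16 powr (p + 1)" by (simp add: powr_add)
  also have "\<dots> \<le> 16 powr l" using l by (intro powr_mono) auto
  finally have "?c * 16 \<le> 16 ^ l" by (simp add: powr_realpow)
  then have "?c * 4 \<le> 16 ^ l" using powr_ge_zero[of 16 p] by linarith
  then have c\<epsilon>: "?c * ?\<epsilon> \<le> 1 / 2" by (simp add: field_simps)
  let ?P = "\<lambda>i. ?c ^ i * prob (survives U (16 ^ i))"
  show ?thesis
  proof (rule contraction_tendsto_zero)
    show "0 \<le> ?c ^ i * passage_bound U ?\<epsilon> i" for i
      by (intro mult_nonneg_nonneg passage_bound_nonneg) auto
    show "?c ^ Suc i * passage_bound U ?\<epsilon> (Suc i) \<le> ?c ^ i * passage_bound U ?\<epsilon> i / 2 + ?c * ?P i" for i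
      using mult_right_mono[OF c\<epsilon>, of "?c ^ i * passage_bound U ?\<epsilon> i"]
      by (simp add: passage_bound_nonneg algebra_simps)
    have "(\<lambda>i. ?c * ?P i) \<longlonglongrightarrow> ?c * 0"
      by (intro tendsto_intros survival_decay[OF U p moment])
    then show "(\<lambda>i. ?c * ?P i) \<longlonglongrightarrow> 0" by simp
  qed
qed

text \<open>Below level \<open>4 ^ (i + l)\<close> only survival is used. Layer \<open>j\<close>
  above it has weight \<open>c ^ Suc (i + l + j)\<close> and probability at most
  \<open>\<epsilon> ^ j * passage_bound U \<epsilon> i\<close>; as
  \<open>c * \<epsilon> <= 1 / 2\<close>, a geometric series with sum \<open>2\<close>
  results.\<close>

lemma nn_integral_survives_le:
  fixes p :: real and l :: nat
  assumes U [measurable]: "U \<in> sets borel" and p: "p > 0" and l: "p + 1 \<le> l" "cmod a \<le> 4 ^ l"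
  defines "c \<equiv> 16 powr p" and "\<epsilon> \<equiv> 2 / 16 ^ l"
  shows "(\<integral>\<^sup>+\<omega>. indicator (survives U (16 ^ i)) \<omega> * ennreal (1 + cmod (B (real (16 ^ i)) \<omega>) powr (2 * p)) \<partial>M)
    \<le> ennreal ((1 + c ^ (i + l)) * prob (survives U (16 ^ i)) + 2 * c ^ Suc l * (c ^ i * passage_bound U \<epsilon> i))"
proof -
  let ?S = "survives U (16 ^ i)" and ?b = "\<lambda>\<omega>. cmod (B (real (16 ^ i)) \<omega>)"
  let ?z = "c ^ i * passage_bound U \<epsilon> i"
  define A where "A j = ?S \<inter> {\<omega>. 4 ^ (i + l + j) < ?b \<omega>}" for j
  have S [measurable]: "?S \<in> sets M" by measurable
  have A [measurable]: "A j \<in> sets M" for j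
  proof -
    have "A j = ?S \<inter> {\<omega> \<in> space M. 4 ^ (i + l + j) < ?b \<omega>}"
      using sets.sets_into_space[OF S] by (auto simp: A_def)
    then show ?thesis by (simp only:) measurable
  qed
  have c: "c \<ge> 1" using p by (simp add: c_def ge_one_powr_ge_zero)
  have z: "?z \<ge> 0" using c by (intro mult_nonneg_nonneg passage_bound_nonneg) (auto simp: \<epsilon>_def)
  have "c * 16 = 16 powr (p + 1)" by (simp add: powr_add c_def)
  also have "\<dots> \<le> 16 powr l" using l by (intro powr_mono) auto
  finally have c\<epsilon>: "c * \<epsilon> \<le> 1 / 2" using c by (simp add: powr_realpow field_simps \<epsilon>_def)
  have PA: "c ^ Suc (i + l + j) * prob (A j) \<le> c ^ Suc l * ?z * (1 / 2) ^ j" for j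
  proof -
    have "prob (A j) \<le> \<epsilon> ^ j * passage_bound U \<epsilon> i"
      using prob_survives_far[OF U l(2), of i j] by (simp add: A_def \<epsilon>_def ac_simps)
    then have "c ^ Suc (i + l + j) * prob (A j) \<le> c ^ Suc (i + l + j) * (\<epsilon> ^ j * passage_bound U \<epsilon> i)"
      using c by (intro mult_left_mono) auto
    also have "\<dots> = c ^ Suc l * ?z * (c * \<epsilon>) ^ j"
      by (simp add: power_add power_mult_distrib mult_ac)
    also have "\<dots> \<le> c ^ Suc l * ?z * (1 / 2) ^ j"
    proof (rule mult_left_mono[OF power_mono[OF c\<epsilon>]])
      show "0 \<le> c * \<epsilon>" using c by (simp add: \<epsilon>_def)
      show "0 \<le> c ^ Suc l * ?z" by (rule mult_nonneg_nonneg[OF _ z]) (use c in simp)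
    qed
    finally show ?thesis .
  qed
  have "(\<integral>\<^sup>+\<omega>. indicator ?S \<omega> * ennreal (1 + ?b \<omega> powr (2 * p)) \<partial>M)
    \<le> (\<integral>\<^sup>+\<omega>. ennreal (1 + c ^ (i + l)) * indicator ?S \<omega>
        + (\<Sum>j. ennreal (c ^ Suc (i + l + j)) * indicator (A j) \<omega>) \<partial>M)"
  proof (rule nn_integral_mono)
    fix \<omega>
    show "indicator ?S \<omega> * ennreal (1 + ?b \<omega> powr (2 * p))
      \<le> ennreal (1 + c ^ (i + l)) * indicator ?S \<omega> + (\<Sum>j. ennreal (c ^ Suc (i + l + j)) * indicator (A j) \<omega>)"
      using dyadic_layer_bound[OF p, of "?b \<omega>" "i + l"]
      by (cases "\<omega> \<in> ?S") (simp_all add: A_def c_def indicator_def)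
  qed
  also have "\<dots> = ennreal (1 + c ^ (i + l)) * emeasure M ?S
      + (\<Sum>j. ennreal (c ^ Suc (i + l + j)) * emeasure M (A j))"
    by (subst nn_integral_add, measurable, subst nn_integral_suminf, measurable)
      (simp add: nn_integral_cmult_indicator)
  also have "(\<Sum>j. ennreal (c ^ Suc (i + l + j)) * emeasure M (A j))
      \<le> (\<Sum>j. ennreal (c ^ Suc l * ?z * (1 / 2) ^ j))"
    using PA c by (intro suminf_le) (auto simp: emeasure_eq_measure ennreal_mult'[symmetric] intro!: ennreal_leI simp del: power_Suc)
  also have "\<dots> = ennreal (c ^ Suc l * ?z * 2)"
  proof (rule suminf_ennreal_eq)
    show "(\<lambda>j. c ^ Suc l * ?z * (1 / 2) ^ j) sums (c ^ Suc l * ?z * 2)"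
      using geometric_sums[of "1 / 2 :: real"] by (intro sums_mult) simp
    show "0 \<le> c ^ Suc l * ?z * (1 / 2) ^ j" for j
      by (intro mult_nonneg_nonneg[OF mult_nonneg_nonneg[OF _ z]]) (use c in auto)
  qed
  also have "ennreal (1 + c ^ (i + l)) * emeasure M ?S + ennreal (c ^ Suc l * ?z * 2)
      = ennreal ((1 + c ^ (i + l)) * prob ?S + c ^ Suc l * ?z * 2)"
    using c z by (simp add: emeasure_eq_measure ennreal_mult'[symmetric] ennreal_plus[symmetric] del: ennreal_plus power_Suc)
  finally show ?thesis by (simp add: mult_ac add_left_mono del: power_Suc)
qed

lemma admissible_zero_at_start:
  assumes p: "p > 0" and moment: "exit_time_moment M B W p < \<infinity>" and g: "admissible W p g"
  shows "g a = 0"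
proof -
  obtain U D where cont: "continuous_on UNIV g" and nonneg: "\<And>z. 0 \<le> g z"
    and sub: "locally_submean_on UNIV g" and U: "closed U" "U \<subseteq> W" "\<And>z. z \<notin> U \<Longrightarrow> g z = 0"
    and D: "\<And>z. g z \<le> D * (1 + cmod z powr (2 * p))"
    using g unfolding admissible_def by blast
  have [measurable]: "U \<in> sets borel" using U(1) by simp
  have "0 \<le> D * (1 + cmod 0 powr (2 * p))" using nonneg[of 0] D[of 0] by linarith
  then have D0: "D \<ge> 0" by simp
  obtain l1 :: nat where l1: "p + 1 \<le> l1" using real_arch_simple by blast
  obtain l2 where l2: "cmod a < 4 ^ l2" using real_arch_pow[of 4 "cmod a"] by auto
  \<comment> \<open>The summand \<open>l1\<close> provides the contraction, and \<open>l2\<close>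
    puts the starting point below the lowest level.\<close>
  define l where "l = l1 + l2"
  have "(4 :: real) ^ l2 \<le> 4 ^ l" unfolding l_def by (rule power_increasing) auto
  with l2 have l: "p + 1 \<le> l" "cmod a \<le> 4 ^ l" using l1 by (simp add: l_def, linarith)
  define c where "c = (16 :: real) powr p"
  define Y where "Y i = passage_bound U (2 / 16 ^ l) i" for i
  define P where "P i = prob (survives U (16 ^ i))" for i
  have c: "c \<ge> 1" using p by (simp add: c_def ge_one_powr_ge_zero)
  have fin: "(\<integral>\<^sup>+\<omega>. ennreal (g (B (real t) \<omega>)) \<partial>M) < \<infinity>" if "t > 0" for t :: nat
  proof -
    have "(\<integral>\<^sup>+\<omega>. ennreal (g (B (real t) \<omega>)) \<partial>M)
      \<le> (\<integral>\<^sup>+\<omega>. ennreal (D * (1 + (2 * p) powr (2 * p))) * ennreal (exp (cmod (B (real t) \<omega>))) \<partial>M)"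
    proof (rule nn_integral_mono)
      fix \<omega>
      let ?b = "cmod (B (real t) \<omega>)"
      have "1 + ?b powr (2 * p) \<le> exp ?b + (2 * p) powr (2 * p) * exp ?b"
        using powr_le_exp[of "2 * p" ?b] p by (intro add_mono) auto
      then have "D * (1 + ?b powr (2 * p)) \<le> D * ((1 + (2 * p) powr (2 * p)) * exp ?b)"
        using D0 by (intro mult_left_mono) (auto simp: algebra_simps)
      then have "g (B (real t) \<omega>) \<le> D * (1 + (2 * p) powr (2 * p)) * exp ?b"
        using D[of "B (real t) \<omega>"] by (simp add: mult.assoc)
      then show "ennreal (g (B (real t) \<omega>)) \<le> ennreal (D * (1 + (2 * p) powr (2 * p))) * ennreal (exp ?b)"
        by (simp add: ennreal_mult''[symmetric] ennreal_leI)
    qed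
    also have "\<dots> = ennreal (D * (1 + (2 * p) powr (2 * p))) * (\<integral>\<^sup>+\<omega>. ennreal (exp (cmod (B (real t) \<omega>))) \<partial>M)"
      by (rule nn_integral_cmult) measurable
    also have "\<dots> < \<infinity>"
      using nn_integral_exp_norm_finite[of "real t"] that by (simp add: ennreal_mult_less_top)
    finally show ?thesis .
  qed
  define b where "b i = D * ((1 + c ^ (i + l)) * P i + 2 * c ^ Suc l * (c ^ i * Y i))" for i
  have le: "g a \<le> b i" for i
  proof -
    have "ennreal (g a) \<le> (\<integral>\<^sup>+\<omega>. indicator (survives U (16 ^ i)) \<omega> * ennreal (g (B (real (16 ^ i)) \<omega>)) \<partial>M)"
      by (intro admissible_le_survival cont nonneg sub U fin) auto
    also have "\<dots> \<le> (\<integral>\<^sup>+\<omega>. ennreal D * (indicator (survives U (16 ^ i)) \<omega>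
        * ennreal (1 + cmod (B (real (16 ^ i)) \<omega>) powr (2 * p))) \<partial>M)"
    proof (rule nn_integral_mono)
      fix \<omega>
      have "ennreal (g (B (real (16 ^ i)) \<omega>)) \<le> ennreal D * ennreal (1 + cmod (B (real (16 ^ i)) \<omega>) powr (2 * p))"
        unfolding ennreal_mult'[OF D0, symmetric] by (intro ennreal_leI D)
      then show "indicator (survives U (16 ^ i)) \<omega> * ennreal (g (B (real (16 ^ i)) \<omega>))
        \<le> ennreal D * (indicator (survives U (16 ^ i)) \<omega> * ennreal (1 + cmod (B (real (16 ^ i)) \<omega>) powr (2 * p)))"
        by (simp add: indicator_def)
    qed
    also have "\<dots> = ennreal D * (\<integral>\<^sup>+\<omega>. indicator (survives U (16 ^ i)) \<omega>
        * ennreal (1 + cmod (B (real (16 ^ i)) \<omega>) powr (2 * p)) \<partial>M)"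
      by (rule nn_integral_cmult) measurable
    also have "\<dots> \<le> ennreal D * ennreal ((1 + c ^ (i + l)) * P i + 2 * c ^ Suc l * (c ^ i * Y i))"
      unfolding c_def P_def Y_def by (intro mult_left_mono nn_integral_survives_le p l) auto
    also have "\<dots> = ennreal (b i)" using D0 by (simp add: b_def ennreal_mult')
    finally show ?thesis
    proof (subst (asm) ennreal_le_iff)
      have "Y i \<ge> 0" "P i \<ge> 0" by (simp_all add: Y_def P_def passage_bound_nonneg)
      then show "0 \<le> b i" using D0 c by (simp add: b_def)
    qed
  qed
  have cP: "(\<lambda>i. c ^ i * P i) \<longlonglongrightarrow> 0"
    unfolding c_def P_def by (rule survival_decay[OF U(1,2) p moment])
  have cY: "(\<lambda>i. c ^ i * Y i) \<longlonglongrightarrow> 0"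
    unfolding c_def Y_def by (rule passage_bound_decay[OF U(1,2) p moment l(1)])
  \<comment> \<open>The constant \<open>1\<close> in the growth bound leaves the bare survival
    probability, which is dominated by the weighted one because \<open>c >= 1\<close>.\<close>
  have "P \<longlonglongrightarrow> 0"
  proof (rule tendsto_sandwich[OF _ _ tendsto_const cP])
    show "\<forall>\<^sub>F i in sequentially. P i \<le> c ^ i * P i"
      using c by (intro always_eventually) (auto simp: P_def mult_le_cancel_right1)
  qed (simp add: P_def)
  then have "(\<lambda>i. D * ((P i + c ^ l * (c ^ i * P i)) + 2 * c ^ Suc l * (c ^ i * Y i)))
      \<longlonglongrightarrow> D * ((0 + c ^ l * 0) + 2 * c ^ Suc l * 0)"
    by (intro tendsto_intros cP cY)
  moreover have "(\<lambda>i. D * ((P i + c ^ l * (c ^ i * P i)) + 2 * c ^ Suc l * (c ^ i * Y i))) = b"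
    by (simp add: b_def fun_eq_iff power_add algebra_simps)
  ultimately have "b \<longlonglongrightarrow> 0" by simp
  then have "g a \<le> 0" using le by (intro LIMSEQ_le_const) auto
  then show ?thesis using nonneg[of a] by simp
qed

end

section \<open>Passage to the bound for \<open>f\<close>\<close>

theorem theorem1:
  fixes M :: "'w measure" and B :: "real \<Rightarrow> 'w \<Rightarrow> complex" and a :: complex
    and W :: "complex set" and f :: "complex \<Rightarrow> complex" and p K C :: real
  assumes "p > 0"
    and "open W" and "connected W" and "W \<noteq> {}"
    and "a \<in> W" and "planar_brownian_motion M B a"
    and "exit_time_moment M B W p < \<infinity>"
    and "f analytic_on W"
    and "\<And>\<zeta>. \<zeta> \<in> frontier W \<Longrightarrow> Limsup (at \<zeta> within W) (\<lambda>z. ereal (cmod (f z))) \<le> ereal K"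
    and "C > 0"
    and "\<And>z. z \<in> W \<Longrightarrow> cmod (f z) \<le> C * exp (C * cmod z powr (2 * p)) + C"
  shows "\<forall>z\<in>W. cmod (f z) \<le> K"
proof
  fix z assume z: "z \<in> W"
  interpret planar_brownian_motion M B a by fact
  \<comment> \<open>A boundary point is wanted in order to get \<open>K >= 0\<close>, so that every
    \<open>L > K\<close> is positive. On the whole plane every path has exit time
    \<open>\<infinity>\<close>, contrary to the finite moment.\<close>
  have "W \<noteq> UNIV"
  proof
    assume "W = UNIV"
    then have "exit_time_moment M B W p = (\<integral>\<^sup>+\<omega>. \<infinity> \<partial>M)"
      by (simp add: exit_time_moment_def exit_time_def ennreal_rpow_def)
    with assms(7) show False by (simp add: emeasure_space_1)
  qed
  then obtain \<zeta> where \<zeta>: "\<zeta> \<in> frontier W"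
    using frontier_eq_empty[of W] \<open>W \<noteq> {}\<close> by auto
  have "\<zeta> \<notin> W" "\<zeta> \<in> closure W"
    using \<zeta> \<open>open W\<close> by (auto simp: frontier_def interior_open)
  then have "at \<zeta> within W \<noteq> bot"
    by (simp add: trivial_limit_within closure_def)
  then have "ereal 0 \<le> Limsup (at \<zeta> within W) (\<lambda>z. ereal (cmod (f z)))"
    by (intro le_Limsup) auto
  also have "\<dots> \<le> ereal K" by (rule assms(9)) fact
  finally have K: "K \<ge> 0" by simp
  show "cmod (f z) \<le> K"
  proof (rule dense_ge)
    fix L assume L: "K < L"
    let ?g = "\<lambda>z. if z \<in> W then ln (max 1 (cmod (f z) / L)) else 0"
    \<comment> \<open>The slack between \<open>K\<close> and \<open>L\<close> makes the limsup bound
      strict, as \<open>admissible_ln_norm\<close> requires.\<close>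
    have "Limsup (at \<zeta> within W) (\<lambda>z. ereal (cmod (f z))) < ereal L" if "\<zeta> \<in> frontier W" for \<zeta>
      using assms(9)[OF that] L by (simp add: le_less_trans)
    then have "admissible W p ?g"
      using K L assms(2,10,11) analytic_imp_holomorphic[OF assms(8)]
      by (intro admissible_ln_norm[where C = C]) auto
    from admissible_zero_propagates[OF assms(2,3,5) _ this z]
    have "?g z = 0" using admissible_zero_at_start[OF assms(1,7)] by blast
    then have "max 1 (cmod (f z) / L) \<le> 1"
      using z by (simp add: ln_eq_zero_iff)
    then show "cmod (f z) \<le> L" using K L by (simp add: pos_divide_le_eq)
  qed
qed

end
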